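(* Let $\varepsilon>0$. There exists a constant $c_\varepsilon>0$ such that the following holds: for all integers $n\ge 1$ and $r\ge 1$ and every regular word with constants $w\in S_n\ast\mathbb F_r$ of length $l\ge 1$, we have $$d\big(\Sigma(\mu^{S_n}_{w}),\mu^{S_n}_{\rm unif}\big)\le c_\varepsilon\, l^2\, n^{-1/3+\varepsilon},$$ where $d$ denotes the Kantorovich-Rubinstein metric on ${\rm P}(S_n)$ associated with the normalized Hamming metric.
   Context: $S_n$ is the symmetric group on $\{1,\dots,n\}$ and $\mathbb F_r=\langle x_1,\dots,x_r\rangle$ is the free group of rank $r$. Words with constants. A word with constants in a group $G$ and in $r$ variables is an element $w=c_0x_{\iota(1)}^{\varepsilon(1)}c_1\cdots c_{l-1}x_{\iota(l)}^{\varepsilon(l)}c_l$ of the free product $G\ast\mathbb F_r$, with $\iota(j)\in\{1,\dots,r\}$, $\varepsilon(j)\in\{\pm1\}$ and $c_0,\dots,c_l\in G$. It is reduced if, for $j\in\{1,\dots,l-1\}$, $\iota(j)=\iota(j+1)$ and $\varepsilon(j)=-\varepsilon(j+1)$ implies $c_j\notin Z(G)$. All words with constants are assumed to be reduced (written in reduced form). The length of the reduced word $w$ is $l$. The critical indices of $w$ are the $j\in\{1,\dots,l-1\}$ with $\iota(j)=\iota(j+1)$ and $\varepsilon(j)=-\varepsilon(j+1)$; the constants $c_j$ at critical indices $j$ are the critical constants of $w$. Regular. A word with constants $w\in S_n\ast\mathbb F_r$ is regular if $w$ is not conjugate (in $S_n\ast\mathbb F_r$) to an element of $S_n$ and each critical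 constant of $w^2$ (written in reduced form) is a fixed-point-free permutation of $\{1,\dots,n\}$. Word map and measures. For $g_1,\dots,g_r\in G$, $w(g_1,\dots,g_r)\in G$ is the image of $w$ under the homomorphism $G\ast\mathbb F_r\to G$ that is the identity on $G$ and maps $x_i\mapsto g_i$. For finite $G$, ${\rm P}(G)$ is the set of probability measures on $G$, and $\mu^G_w\in{\rm P}(G)$ is the push-forward of the normalized counting measure on $G^r$ under $w\colon G^r\to G$. The uniform probability measure on $S_n$ is $\mu^{S_n}_{\rm unif}$. For $\mu\in{\rm P}(S_n)$, its symmetrization is $\Sigma(\mu)(A)=\frac1{n!}\sum_{\sigma\in S_n}\mu(A^\sigma)$, where $A^\sigma=\sigma^{-1}A\sigma$. Metrics. The normalized Hamming metric on $S_n$ is $d(\sigma,\tau)=\frac1n|\{i\in\{1,\dots,n\}\mid\sigma(i)\ne\tau(i)\}|$. The Kantorovich-Rubinstein metric on ${\rm P}(S_n)$ is $$d(\mu,\nu)=\min\Big\{\int d(\sigma,\tau)\,d\gamma(\sigma,\tau)\ \Big|\ \gamma\in{\rm P}(S_n\times S_n),\ \pi_{1,*}(\gamma)=\mu,\ \pi_{2,*}(\gamma)=\nu\Big\},$$ where $\pi_1,\pi_2$ are the coordinate projections. *)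

theory Defs
  imports "HOL-Algebra.Sym_Groups" "HOL-Probability.Probability"
begin

section \<open>The free product of a group with a free group\<close>

text \<open>
  The free product of \<open>G\<close> with the free group on \<open>x_1, \<dots>, x_r\<close> is built as the quotient of the free
  monoid over the alphabet \<open>G \<union> {x_i, x_i\<^sup>-\<^sup>1 | 1 \<le> i \<le> r}\<close> by the congruence generated by the
  multiplication table of \<open>G\<close> and the cancellations of \<open>x_i\<close> with its inverse. The letter
  \<open>Gen i e\<close>, with \<open>e \<in> {1, -1}\<close>, stands for \<open>x_i\<close> raised to the power \<open>e\<close>.
\<close>

datatype 'a letter = Const 'a | Gen nat int

definition alphabet :: "('a, 'b) monoid_scheme \<Rightarrow> nat \<Rightarrow> 'a letter set" where
  "alphabet G r = Const ` carrier G \<union> {Gen i e | i e. i \<in> {1..r} \<and> e \<in> {1, -1}}"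

inductive fp_cong :: "('a, 'b) monoid_scheme \<Rightarrow> nat \<Rightarrow> 'a letter list \<Rightarrow> 'a letter list \<Rightarrow> bool"
  for G (structure) and r where
  refl: "u \<in> lists (alphabet G r) \<Longrightarrow> fp_cong G r u u"
| sym: "fp_cong G r u v \<Longrightarrow> fp_cong G r v u"
| trans: "fp_cong G r u v \<Longrightarrow> fp_cong G r v w \<Longrightarrow> fp_cong G r u w"
| append: "fp_cong G r u u' \<Longrightarrow> fp_cong G r v v' \<Longrightarrow> fp_cong G r (u @ v) (u' @ v')"
| mult: "a \<in> carrier G \<Longrightarrow> b \<in> carrier G \<Longrightarrow> fp_cong G r [Const a, Const b] [Const (a \<otimes> b)]"
| one: "fp_cong G r [Const \<one>] []"
| cancel: "i \<in> {1..r} \<Longrightarrow> e \<in> {1, -1} \<Longrightarrow> fp_cong G r [Gen i e, Gen i (- e)] []"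

definition fp_rel :: "('a, 'b) monoid_scheme \<Rightarrow> nat \<Rightarrow> ('a letter list \<times> 'a letter list) set" where
  "fp_rel G r = {(u, v). fp_cong G r u v}"

abbreviation fp_class :: "('a, 'b) monoid_scheme \<Rightarrow> nat \<Rightarrow> 'a letter list \<Rightarrow> 'a letter list set" where
  "fp_class G r u \<equiv> fp_rel G r `` {u}"

definition free_prod :: "('a, 'b) monoid_scheme \<Rightarrow> nat \<Rightarrow> 'a letter list set monoid" where
  "free_prod G r =
     \<lparr> carrier = lists (alphabet G r) // fp_rel G r,
       mult = (\<lambda>X Y. \<Union>u\<in>X. \<Union>v\<in>Y. fp_class G r (u @ v)),
       one = fp_class G r [] \<rparr>"

lemma fp_cong_lists:
  assumes "group G" "fp_cong G r u v"
  shows "u \<in> lists (alphabet G r) \<and> v \<in> lists (alphabet G r)"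
proof -
  interpret group G by fact
  show ?thesis using assms(2) by induction (auto simp: alphabet_def)
qed

lemma fp_rel_equiv:
  assumes "group G" shows "equiv (lists (alphabet G r)) (fp_rel G r)"
proof (rule equivI)
  show "fp_rel G r \<subseteq> lists (alphabet G r) \<times> lists (alphabet G r)"
    unfolding fp_rel_def using fp_cong_lists[OF assms] by blast
  show "refl_on (lists (alphabet G r)) (fp_rel G r)"
    by (auto simp: refl_on_def fp_rel_def intro: fp_cong.refl)
  show "Relation.sym (fp_rel G r)"
    by (auto simp: sym_def fp_rel_def intro: fp_cong.sym)
  show "Relation.trans (fp_rel G r)"
    by (auto simp: trans_def fp_rel_def intro: fp_cong.trans)
qed

lemma fp_class_eq:
  assumes "group G" "fp_cong G r u v" shows "fp_class G r u = fp_class G r v"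
  using equiv_class_eq[OF fp_rel_equiv[OF assms(1)]] assms(2) by (auto simp: fp_rel_def)

lemma fp_class_eq_iff:
  assumes "group G" "u \<in> lists (alphabet G r)" "v \<in> lists (alphabet G r)"
  shows "fp_class G r u = fp_class G r v \<longleftrightarrow> fp_cong G r u v"
  using eq_equiv_class_iff[OF fp_rel_equiv[OF assms(1)] assms(2,3)] by (simp add: fp_rel_def)

lemma free_prod_carrier:
  "X \<in> carrier (free_prod G r) \<longleftrightarrow> (\<exists>u\<in>lists (alphabet G r). X = fp_class G r u)"
  by (auto simp: free_prod_def quotient_def)

lemma free_prod_one: "\<one>\<^bsub>free_prod G r\<^esub> = fp_class G r []"
  by (simp add: free_prod_def)

lemma free_prod_mult:
  assumes "group G" "u \<in> lists (alphabet G r)" "v \<in> lists (alphabet G r)"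
  shows "fp_class G r u \<otimes>\<^bsub>free_prod G r\<^esub> fp_class G r v = fp_class G r (u @ v)"
proof -
  have "fp_class G r (u' @ v') = fp_class G r (u @ v)"
    if "u' \<in> fp_class G r u" "v' \<in> fp_class G r v" for u' v'
  proof -
    have "fp_cong G r u u'" "fp_cong G r v v'" using that by (simp_all add: fp_rel_def)
    then show ?thesis
      by (intro fp_class_eq[OF assms(1)]) (rule fp_cong.sym, rule fp_cong.append)
  qed
  moreover have "u \<in> fp_class G r u" "v \<in> fp_class G r v"
    using fp_cong.refl[OF assms(2)] fp_cong.refl[OF assms(3)] by (simp_all add: fp_rel_def)
  ultimately have "(\<Union>u'\<in>fp_class G r u. \<Union>v'\<in>fp_class G r v. fp_class G r (u' @ v')) = fp_class G r (u @ v)"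
    by blast
  then show ?thesis by (simp add: free_prod_def)
qed

lemma letter_inverse:
  assumes "group G" "x \<in> alphabet G r"
  shows "\<exists>y\<in>alphabet G r. fp_cong G r [y, x] []"
proof -
  interpret group G by fact
  consider a where "x = Const a" "a \<in> carrier G" | i e where "x = Gen i e" "i \<in> {1..r}" "e \<in> {1, -1}"
    using assms(2) by (auto simp: alphabet_def)
  then show ?thesis
  proof cases
    case 1
    then have "fp_cong G r [Const (inv\<^bsub>G\<^esub> a), x] [Const (inv\<^bsub>G\<^esub> a \<otimes>\<^bsub>G\<^esub> a)]"
      using fp_cong.mult[of "inv\<^bsub>G\<^esub> a" G a r] by simp
    with 1 have "fp_cong G r [Const (inv\<^bsub>G\<^esub> a), x] []"
      using fp_cong.trans[OF _ fp_cong.one] by simp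
    with 1 show ?thesis by (auto simp: alphabet_def)
  next
    case 2
    then have "fp_cong G r [Gen i (- e), Gen i (- (- e))] []"
      by (intro fp_cong.cancel) auto
    with 2 show ?thesis by (intro bexI[of _ "Gen i (- e)"]) (auto simp: alphabet_def)
  qed
qed

lemma word_inverse:
  assumes "group G" "u \<in> lists (alphabet G r)"
  shows "\<exists>v\<in>lists (alphabet G r). fp_cong G r (v @ u) []"
  using assms(2)
proof induction
  case Nil
  show ?case using fp_cong.refl[of "[]" G r] by auto
next
  case (Cons x u)
  then obtain v where v: "v \<in> lists (alphabet G r)" "fp_cong G r (v @ u) []" by auto
  obtain y where y: "y \<in> alphabet G r" "fp_cong G r [y, x] []"
    using letter_inverse[OF assms(1) Cons(1)] by auto
  have "fp_cong G r ([y, x] @ u) ([] @ u)"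
    using fp_cong.append[OF y(2) fp_cong.refl[OF Cons(2)]] by simp
  then have "fp_cong G r (v @ ([y, x] @ u)) (v @ ([] @ u))"
    using fp_cong.append[OF fp_cong.refl[OF v(1)]] by blast
  then have "fp_cong G r ((v @ [y]) @ x # u) []"
    using v(2) fp_cong.trans by fastforce
  then show ?case using v y by (intro bexI[of _ "v @ [y]"]) auto
qed

lemma free_prod_group:
  assumes "group G" shows "group (free_prod G r)"
proof (rule groupI)
  fix X assume "X \<in> carrier (free_prod G r)"
  then obtain u where u: "u \<in> lists (alphabet G r)" "X = fp_class G r u"
    unfolding free_prod_carrier by blast
  obtain v where v: "v \<in> lists (alphabet G r)" "fp_cong G r (v @ u) []"
    using word_inverse[OF assms u(1)] by blast
  have "fp_class G r v \<in> carrier (free_prod G r)"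
    unfolding free_prod_carrier using v by blast
  moreover have "fp_class G r v \<otimes>\<^bsub>free_prod G r\<^esub> X = \<one>\<^bsub>free_prod G r\<^esub>"
    unfolding u(2) free_prod_mult[OF assms v(1) u(1)] free_prod_one by (rule fp_class_eq[OF assms v(2)])
  ultimately show "\<exists>Y\<in>carrier (free_prod G r). Y \<otimes>\<^bsub>free_prod G r\<^esub> X = \<one>\<^bsub>free_prod G r\<^esub>"
    by blast
next
  fix X Y assume "X \<in> carrier (free_prod G r)" "Y \<in> carrier (free_prod G r)"
  then obtain u v where uv: "u \<in> lists (alphabet G r)" "X = fp_class G r u"
      "v \<in> lists (alphabet G r)" "Y = fp_class G r v"
    unfolding free_prod_carrier by blast
  then have "u @ v \<in> lists (alphabet G r)" by simp
  then show "X \<otimes>\<^bsub>free_prod G r\<^esub> Y \<in> carrier (free_prod G r)"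
    unfolding uv(2,4) free_prod_mult[OF assms uv(1,3)] free_prod_carrier by blast
next
  fix X Y Z
  assume "X \<in> carrier (free_prod G r)" "Y \<in> carrier (free_prod G r)" "Z \<in> carrier (free_prod G r)"
  then obtain u v w where uvw: "u \<in> lists (alphabet G r)" "X = fp_class G r u"
      "v \<in> lists (alphabet G r)" "Y = fp_class G r v"
      "w \<in> lists (alphabet G r)" "Z = fp_class G r w"
    unfolding free_prod_carrier by blast
  then have "u @ v \<in> lists (alphabet G r)" "v @ w \<in> lists (alphabet G r)" by simp_all
  then show "X \<otimes>\<^bsub>free_prod G r\<^esub> Y \<otimes>\<^bsub>free_prod G r\<^esub> Z = X \<otimes>\<^bsub>free_prod G r\<^esub> (Y \<otimes>\<^bsub>free_prod G r\<^esub> Z)"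
    unfolding uvw(2,4,6) using uvw(1,3,5) by (simp only: free_prod_mult[OF assms] append_assoc)
next
  show "\<one>\<^bsub>free_prod G r\<^esub> \<in> carrier (free_prod G r)"
    unfolding free_prod_one free_prod_carrier by (rule bexI[of _ "[]"]) auto
next
  fix X assume "X \<in> carrier (free_prod G r)"
  then obtain u where u: "u \<in> lists (alphabet G r)" "X = fp_class G r u"
    unfolding free_prod_carrier by blast
  show "\<one>\<^bsub>free_prod G r\<^esub> \<otimes>\<^bsub>free_prod G r\<^esub> X = X"
    unfolding free_prod_one u(2) free_prod_mult[OF assms lists.Nil u(1)] by simp
qed

definition const_elem :: "('a, 'b) monoid_scheme \<Rightarrow> nat \<Rightarrow> 'a \<Rightarrow> 'a letter list set" where
  "const_elem G r a = fp_class G r [Const a]"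

definition gen_elem :: "('a, 'b) monoid_scheme \<Rightarrow> nat \<Rightarrow> nat \<Rightarrow> 'a letter list set" where
  "gen_elem G r i = fp_class G r [Gen i 1]"


section \<open>Substitution\<close>

primrec letter_val :: "('a, 'b) monoid_scheme \<Rightarrow> (nat \<Rightarrow> 'a) \<Rightarrow> 'a letter \<Rightarrow> 'a" where
  "letter_val G g (Const a) = a"
| "letter_val G g (Gen i e) = g i [^]\<^bsub>G\<^esub> e"

definition letters_val :: "('a, 'b) monoid_scheme \<Rightarrow> (nat \<Rightarrow> 'a) \<Rightarrow> 'a letter list \<Rightarrow> 'a" where
  "letters_val G g u = foldr (\<lambda>x y. letter_val G g x \<otimes>\<^bsub>G\<^esub> y) u \<one>\<^bsub>G\<^esub>"

definition subst_hom :: "('a, 'b) monoid_scheme \<Rightarrow> (nat \<Rightarrow> 'a) \<Rightarrow> 'a letter list set \<Rightarrow> 'a" where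
  "subst_hom G g X = the_elem (letters_val G g ` X)"

text \<open>
  \<^term>\<open>subst_hom G g\<close> is the homomorphism from the free product to \<open>G\<close> that is the identity on \<open>G\<close>
  and maps \<open>x_i\<close> to \<open>g i\<close>.
\<close>

lemma letter_val_closed:
  assumes "group G" "g \<in> {1..r} \<rightarrow> carrier G" "x \<in> alphabet G r"
  shows "letter_val G g x \<in> carrier G"
  using assms group.int_pow_closed[OF assms(1)] by (auto simp: alphabet_def Pi_iff)

lemma letters_val_closed:
  assumes "group G" "g \<in> {1..r} \<rightarrow> carrier G" "u \<in> lists (alphabet G r)"
  shows "letters_val G g u \<in> carrier G"
proof -
  interpret group G by fact
  show ?thesis using assms(3)
    by induction (simp_all add: letters_val_def letter_val_closed[OF assms(1,2)])
qed

lemma letters_val_append: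
  assumes "group G" "g \<in> {1..r} \<rightarrow> carrier G"
    and "u \<in> lists (alphabet G r)" "v \<in> lists (alphabet G r)"
  shows "letters_val G g (u @ v) = letters_val G g u \<otimes>\<^bsub>G\<^esub> letters_val G g v"
proof -
  interpret group G by fact
  show ?thesis using assms(3)
  proof induction
    case Nil
    show ?case using letters_val_closed[OF assms(1,2,4)] by (simp add: letters_val_def)
  next
    case (Cons x u)
    then show ?case
      using letters_val_closed[OF assms(1,2)] letter_val_closed[OF assms(1,2)] assms(4)
      by (simp add: letters_val_def m_assoc)
  qed
qed

lemma letters_val_cong:
  assumes "group G" "g \<in> {1..r} \<rightarrow> carrier G" "fp_cong G r u v"
  shows "letters_val G g u = letters_val G g v"
proof -
  interpret group G by fact
  show ?thesis using assms(3)
  proof induction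
    case (append u u' v v')
    then show ?case
      using fp_cong_lists[OF assms(1) append(1)] fp_cong_lists[OF assms(1) append(2)]
      by (simp only: letters_val_append[OF assms(1,2)])
  next
    case (cancel i e)
    then have gi: "g i \<in> carrier G" using assms(2) by auto
    then show ?case by (simp add: letters_val_def int_pow_neg)
  next
    case (mult a b)
    then show ?case by (simp add: letters_val_def)
  qed (simp_all add: letters_val_def)
qed

lemma subst_hom_class:
  assumes "group G" "g \<in> {1..r} \<rightarrow> carrier G" "u \<in> lists (alphabet G r)"
  shows "subst_hom G g (fp_class G r u) = letters_val G g u"
proof -
  have "v \<in> fp_class G r u \<Longrightarrow> letters_val G g v = letters_val G g u" for v
    using letters_val_cong[OF assms(1,2), of u v] by (simp add: fp_rel_def)
  moreover have "u \<in> fp_class G r u"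
    using fp_cong.refl[OF assms(3)] by (simp add: fp_rel_def)
  ultimately have "letters_val G g ` fp_class G r u = {letters_val G g u}"
    by blast
  then show ?thesis by (simp only: subst_hom_def the_elem_eq)
qed

lemma subst_hom_is_hom:
  assumes "group G" "g \<in> {1..r} \<rightarrow> carrier G"
  shows "subst_hom G g \<in> hom (free_prod G r) G"
proof (rule homI)
  fix X assume "X \<in> carrier (free_prod G r)"
  then obtain u where u: "u \<in> lists (alphabet G r)" "X = fp_class G r u"
    unfolding free_prod_carrier by blast
  show "subst_hom G g X \<in> carrier G"
    unfolding u(2) subst_hom_class[OF assms u(1)] by (rule letters_val_closed[OF assms u(1)])
next
  fix X Y assume "X \<in> carrier (free_prod G r)" "Y \<in> carrier (free_prod G r)"
  then obtain u v where uv: "u \<in> lists (alphabet G r)" "X = fp_class G r u"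
      "v \<in> lists (alphabet G r)" "Y = fp_class G r v"
    unfolding free_prod_carrier by blast
  then have "u @ v \<in> lists (alphabet G r)" by simp
  with uv(1,3) show "subst_hom G g (X \<otimes>\<^bsub>free_prod G r\<^esub> Y) = subst_hom G g X \<otimes>\<^bsub>G\<^esub> subst_hom G g Y"
    unfolding uv(2,4)
    by (simp only: free_prod_mult[OF assms(1)] subst_hom_class[OF assms] letters_val_append[OF assms])
qed

lemma subst_hom_const:
  assumes "group G" "g \<in> {1..r} \<rightarrow> carrier G" "a \<in> carrier G"
  shows "subst_hom G g (const_elem G r a) = a"
proof -
  interpret group G by fact
  have "[Const a] \<in> lists (alphabet G r)" using assms(3) by (simp add: alphabet_def)
  from subst_hom_class[OF assms(1,2) this] assms(3) show ?thesis
    by (simp add: const_elem_def letters_val_def)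
qed

lemma subst_hom_gen:
  assumes "group G" "g \<in> {1..r} \<rightarrow> carrier G" "i \<in> {1..r}"
  shows "subst_hom G g (gen_elem G r i) = g i"
proof -
  interpret group G by fact
  have "[Gen i 1] \<in> lists (alphabet G r)" using assms(3) by (simp add: alphabet_def)
  from subst_hom_class[OF assms(1,2) this] funcset_mem[OF assms(2,3)] show ?thesis
    by (simp add: gen_elem_def letters_val_def)
qed


section \<open>Words with constants\<close>

text \<open>
  The pair \<open>(c_0, [(i_1, e_1, c_1), \<dots>, (i_l, e_l, c_l)])\<close> is the expression
  \<open>c_0 x_{i_1}^{e_1} c_1 \<dots> x_{i_l}^{e_l} c_l\<close>.
\<close>

type_synonym 'a cword = "'a \<times> (nat \<times> int \<times> 'a) list"

definition cword :: "('a, 'b) monoid_scheme \<Rightarrow> nat \<Rightarrow> 'a cword \<Rightarrow> bool" where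
  "cword G r w \<longleftrightarrow> fst w \<in> carrier G \<and>
     (\<forall>(i, e, c) \<in> set (snd w). i \<in> {1..r} \<and> e \<in> {1, -1} \<and> c \<in> carrier G)"

definition cword_elem :: "('a, 'b) monoid_scheme \<Rightarrow> nat \<Rightarrow> 'a cword \<Rightarrow> 'a letter list set" where
  "cword_elem G r w =
     fp_class G r (Const (fst w) # concat (map (\<lambda>(i, e, c). [Gen i e, Const c]) (snd w)))"

definition cword_length :: "'a cword \<Rightarrow> nat" where
  "cword_length w = length (snd w)"

text \<open>The index \<open>j\<close> ranges over \<open>1..l\<close> in the next three definitions, as in the displayed word.\<close>

definition var_index :: "'a cword \<Rightarrow> nat \<Rightarrow> nat" where
  "var_index w j = fst (snd w ! (j - 1))"

definition var_sign :: "'a cword \<Rightarrow> nat \<Rightarrow> int" where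
  "var_sign w j = fst (snd (snd w ! (j - 1)))"

definition word_const :: "'a cword \<Rightarrow> nat \<Rightarrow> 'a" where
  "word_const w j = snd (snd (snd w ! (j - 1)))"

definition critical_indices :: "'a cword \<Rightarrow> nat set" where
  "critical_indices w =
     {j. 1 \<le> j \<and> j < cword_length w \<and>
         var_index w j = var_index w (j + 1) \<and> var_sign w j = - var_sign w (j + 1)}"

definition group_center :: "('a, 'b) monoid_scheme \<Rightarrow> 'a set" where
  "group_center G = {z \<in> carrier G. \<forall>x\<in>carrier G. z \<otimes>\<^bsub>G\<^esub> x = x \<otimes>\<^bsub>G\<^esub> z}"

definition reduced :: "('a, 'b) monoid_scheme \<Rightarrow> 'a cword \<Rightarrow> bool" where
  "reduced G w \<longleftrightarrow> (\<forall>j\<in>critical_indices w. word_const w j \<notin> group_center G)"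

definition reduced_form :: "('a, 'b) monoid_scheme \<Rightarrow> nat \<Rightarrow> 'a cword \<Rightarrow> 'a letter list set \<Rightarrow> bool" where
  "reduced_form G r u X \<longleftrightarrow> cword G r u \<and> reduced G u \<and> cword_elem G r u = X"

definition conjugate_to_const :: "('a, 'b) monoid_scheme \<Rightarrow> nat \<Rightarrow> 'a letter list set \<Rightarrow> bool" where
  "conjugate_to_const G r X \<longleftrightarrow>
     (\<exists>h\<in>carrier (free_prod G r). \<exists>a\<in>carrier G.
        X = h \<otimes>\<^bsub>free_prod G r\<^esub> const_elem G r a \<otimes>\<^bsub>free_prod G r\<^esub> inv\<^bsub>free_prod G r\<^esub> h)"

definition fixed_point_free :: "nat \<Rightarrow> (nat \<Rightarrow> nat) \<Rightarrow> bool" where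
  "fixed_point_free n \<sigma> \<longleftrightarrow> (\<forall>i\<in>{1..n}. \<sigma> i \<noteq> i)"

text \<open>
  When the centre of \<open>G\<close> is trivial, reduced forms are normal forms of the elements of the free
  product. For \<open>n = 2\<close> the centre is all of \<open>S_2\<close>, so an element of the free product need not have a
  reduced form; the definition imposes no condition on critical constants when the square of \<open>w\<close>
  has none.
\<close>

definition regular :: "nat \<Rightarrow> nat \<Rightarrow> (nat \<Rightarrow> nat) cword \<Rightarrow> bool" where
  "regular n r w \<longleftrightarrow> cword (sym_group n) r w \<and> reduced (sym_group n) w \<and>
     \<not> conjugate_to_const (sym_group n) r (cword_elem (sym_group n) r w) \<and>
     (\<forall>u. reduced_form (sym_group n) r u
            (cword_elem (sym_group n) r w [^]\<^bsub>free_prod (sym_group n) r\<^esub> (2::nat)) \<longrightarrow>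
          (\<forall>j\<in>critical_indices u. fixed_point_free n (word_const u j)))"


section \<open>Word measures and symmetrization\<close>

text \<open>
  Probability measures on a finite group \<open>G\<close> are represented as probability mass functions on the
  ambient type with support in \<open>carrier G\<close>.
\<close>

definition word_map :: "('a, 'b) monoid_scheme \<Rightarrow> nat \<Rightarrow> 'a cword \<Rightarrow> (nat \<Rightarrow> 'a) \<Rightarrow> 'a" where
  "word_map G r w g = subst_hom G g (cword_elem G r w)"

definition word_measure :: "('a, 'b) monoid_scheme \<Rightarrow> nat \<Rightarrow> 'a cword \<Rightarrow> 'a pmf" where
  "word_measure G r w = map_pmf (word_map G r w) (pmf_of_set ({1..r} \<rightarrow>\<^sub>E carrier G))"

definition unif_measure :: "nat \<Rightarrow> (nat \<Rightarrow> nat) pmf" where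
  "unif_measure n = pmf_of_set (carrier (sym_group n))"

definition symmetrization :: "nat \<Rightarrow> (nat \<Rightarrow> nat) pmf \<Rightarrow> (nat \<Rightarrow> nat) pmf" where
  "symmetrization n \<mu> =
     do { \<sigma> \<leftarrow> pmf_of_set (carrier (sym_group n));
          \<tau> \<leftarrow> \<mu>;
          return_pmf (\<sigma> \<circ> \<tau> \<circ> inv' \<sigma>) }"

lemma sym_group_finite: "finite (carrier (sym_group n))" "carrier (sym_group n) \<noteq> {}"
    "card (carrier (sym_group n)) = fact n"
proof -
  show "finite (carrier (sym_group n))"
    by (simp add: sym_group_def finite_permutations)
  have "id \<in> carrier (sym_group n)" by (simp add: sym_group_def permutes_id)
  then show "carrier (sym_group n) \<noteq> {}" by blast
  show "card (carrier (sym_group n)) = fact n"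
    by (simp add: sym_group_def card_permutations)
qed

text \<open>The averaging formula for the symmetrization.\<close>

lemma measure_symmetrization:
  "measure (symmetrization n \<mu>) A =
     1 / fact n * (\<Sum>\<sigma>\<in>carrier (sym_group n). measure \<mu> ((\<lambda>a. inv' \<sigma> \<circ> a \<circ> \<sigma>) ` A))"
proof -
  have pre: "(\<lambda>\<tau>. \<sigma> \<circ> \<tau> \<circ> inv' \<sigma>) -` A = (\<lambda>a. inv' \<sigma> \<circ> a \<circ> \<sigma>) ` A"
    if "\<sigma> \<in> carrier (sym_group n)" for \<sigma>
  proof -
    have p: "\<sigma> \<circ> inv' \<sigma> = id" "inv' \<sigma> \<circ> \<sigma> = id"
      using that permutes_inv_o by (auto simp: sym_group_def)
    have q: "\<sigma> (inv' \<sigma> x) = x" "inv' \<sigma> (\<sigma> x) = x" for x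
      using p by (simp_all add: fun_eq_iff)
    show ?thesis
    proof (intro equalityI subsetI)
      fix \<tau> assume "\<tau> \<in> (\<lambda>\<tau>. \<sigma> \<circ> \<tau> \<circ> inv' \<sigma>) -` A"
      then show "\<tau> \<in> (\<lambda>a. inv' \<sigma> \<circ> a \<circ> \<sigma>) ` A"
        by (intro image_eqI[of _ _ "\<sigma> \<circ> \<tau> \<circ> inv' \<sigma>"]) (simp_all add: fun_eq_iff q)
    next
      fix \<tau> assume "\<tau> \<in> (\<lambda>a. inv' \<sigma> \<circ> a \<circ> \<sigma>) ` A"
      then obtain a where a: "a \<in> A" "\<tau> = inv' \<sigma> \<circ> a \<circ> \<sigma>" by blast
      then have "\<sigma> \<circ> \<tau> \<circ> inv' \<sigma> = a" by (simp add: fun_eq_iff q)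
      with a show "\<tau> \<in> (\<lambda>\<tau>. \<sigma> \<circ> \<tau> \<circ> inv' \<sigma>) -` A" by simp
    qed
  qed
  have "measure (symmetrization n \<mu>) A =
      (\<Sum>\<sigma>\<in>carrier (sym_group n). measure (map_pmf (\<lambda>\<tau>. \<sigma> \<circ> \<tau> \<circ> inv' \<sigma>) \<mu>) A) / fact n"
    unfolding symmetrization_def map_pmf_def[symmetric] measure_pmf_bind
    using sym_group_finite[of n]
    by (subst measure_pmf.measure_bind[where N = "count_space UNIV"])
       (auto simp: integral_pmf_of_set measure_pmf_in_subprob_space)
  then show ?thesis using pre by simp
qed


section \<open>Metrics\<close>

definition hamming :: "nat \<Rightarrow> (nat \<Rightarrow> nat) \<Rightarrow> (nat \<Rightarrow> nat) \<Rightarrow> real" where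
  "hamming n \<sigma> \<tau> = 1 / real n * real (card {i\<in>{1..n}. \<sigma> i \<noteq> \<tau> i})"

definition couplings ::
  "nat \<Rightarrow> (nat \<Rightarrow> nat) pmf \<Rightarrow> (nat \<Rightarrow> nat) pmf \<Rightarrow> ((nat \<Rightarrow> nat) \<times> (nat \<Rightarrow> nat)) pmf set" where
  "couplings n \<mu> \<nu> =
     {\<gamma>. set_pmf \<gamma> \<subseteq> carrier (sym_group n) \<times> carrier (sym_group n) \<and>
         map_pmf fst \<gamma> = \<mu> \<and> map_pmf snd \<gamma> = \<nu>}"

text \<open>
  For \<open>\<mu>\<close> and \<open>\<nu>\<close> supported on \<open>S_n\<close> the set of couplings is nonempty and compact, so the infimum
  is a minimum.
\<close>

definition kantorovich :: "nat \<Rightarrow> (nat \<Rightarrow> nat) pmf \<Rightarrow> (nat \<Rightarrow> nat) pmf \<Rightarrow> real" where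
  "kantorovich n \<mu> \<nu> =
     (INF \<gamma>\<in>couplings n \<mu> \<nu>. measure_pmf.expectation \<gamma> (\<lambda>(\<sigma>, \<tau>). hamming n \<sigma> \<tau>))"

end

theory Submission
  imports Defs
begin

text \<open>
  The symmetrization of a measure on \<open>S_n\<close> only remembers cycle types, and the uniform measure is
  conjugation invariant. Two permutations \<open>\<pi>\<close> and \<open>\<tau>\<close> can be conjugated to lie within Hamming distance
  \<open>(a + b) / n\<close>, where \<open>a\<close> and \<open>b\<close> are their numbers of cycles: write out the points cycle by cycle
  and match the two lists (\<open>conjugate_close\<close>). Drawing \<open>\<pi>\<close> and \<open>\<tau>\<close> independently and conjugating the
  matched pair by a common random permutation gives a coupling, so the distance is at most the
  expected number of cycles of \<open>w(g)\<close> plus that of a uniform permutation, divided by \<open>n\<close>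
  (\<open>kantorovich_symmetrization_le\<close>).

  There are at most \<open>n / K\<close> cycles of length at least \<open>K\<close>, and at most as many shorter ones as there
  are points on them. It remains to bound the probability that a point \<open>x\<close> returns to itself
  within fewer than \<open>K\<close> applications of \<open>w(g)\<close>. Follow \<open>x\<close> letter by letter and reveal a value of
  some \<open>g i\<close> or its inverse only when it is needed. As long as each query is new, its answer is
  uniform on the unused points, and at most \<open>m + 2\<close> of these (after \<open>m\<close> queries) close the
  trajectory or make the next query one that has been answered before. The one danger is
  systematic backtracking: after \<open>g i\<close> has sent \<open>p\<close> to \<open>q\<close>, the constant between the two letters may
  fix \<open>q\<close>, and then the inverse of \<open>g i\<close> leads back to \<open>p\<close>. Fixed-point-free critical constants
  exclude it. Hence over \<open>L = K l\<close> letters the probability of a return is at most of order \<open>L\<^sup>2 / n\<close>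
  (\<open>return_probability\<close>).

  The powers of \<open>w\<close> are controlled by the critical constants of the square of \<open>w\<close>: cancelling
  the end of \<open>w\<close> against its beginning conjugates \<open>w\<close> to a word none of whose cyclically critical constants
  has a fixed point (\<open>cyclic_core\<close>), and conjugation does not change the cycle type.

  With \<open>K\<close> of order \<open>n\<close> to the power \<open>1/3\<close> the bounds \<open>1 / K\<close> and \<open>(K l)\<^sup>2 / n\<close> combine to a multiple
  of \<open>l\<^sup>2\<close> times \<open>n\<close> to the power \<open>-1/3\<close>. The uniform measure is the measure of the word \<open>x_1\<close>, so it
  obeys the same bound.
\<close>

section \<open>Coupling two conjugation invariant measures\<close>

abbreviation Sym :: "nat \<Rightarrow> (nat \<Rightarrow> nat) set" where
  "Sym n \<equiv> carrier (sym_group n)"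

lemma Sym_comp: "\<sigma> \<in> Sym n \<Longrightarrow> \<tau> \<in> Sym n \<Longrightarrow> \<sigma> \<circ> \<tau> \<in> Sym n"
  by (simp add: sym_group_carrier permutes_compose)

lemma Sym_inv: "\<sigma> \<in> Sym n \<Longrightarrow> inv' \<sigma> \<in> Sym n"
  by (simp add: sym_group_carrier permutes_inv)

lemma Sym_inverses:
  assumes "\<sigma> \<in> Sym n" shows "\<sigma> (inv' \<sigma> x) = x" "inv' \<sigma> (\<sigma> x) = x"
  using assms by (auto simp: sym_group_carrier permutes_inverses)

lemma Sym_conj: "\<sigma> \<in> Sym n \<Longrightarrow> \<tau> \<in> Sym n \<Longrightarrow> \<sigma> \<circ> \<tau> \<circ> inv' \<sigma> \<in> Sym n"
  by (simp add: Sym_comp Sym_inv)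

lemma Sym_inv_comp:
  assumes "\<sigma> \<in> Sym n" "\<tau> \<in> Sym n" shows "inv' (\<sigma> \<circ> \<tau>) = inv' \<tau> \<circ> inv' \<sigma>"
  using assms by (simp add: sym_group_carrier o_inv_distrib permutes_bij)

lemma unif_measure_translate:
  assumes "\<rho> \<in> Sym n" shows "map_pmf (\<lambda>\<sigma>. \<sigma> \<circ> \<rho>) (unif_measure n) = unif_measure n"
proof -
  have "bij_betw (\<lambda>\<sigma>. \<sigma> \<circ> \<rho>) (Sym n) (Sym n)"
    by (rule bij_betw_byWitness[where f' = "\<lambda>\<sigma>. \<sigma> \<circ> inv' \<rho>"])
       (auto simp: fun_eq_iff Sym_inverses[OF assms] assms Sym_comp Sym_inv)
  then show ?thesis
    unfolding unif_measure_def by (rule map_pmf_of_set_bij_betw) (simp_all add: sym_group_finite)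
qed

lemma unif_measure_conj:
  assumes "\<rho> \<in> Sym n" shows "map_pmf (\<lambda>\<sigma>. \<rho> \<circ> \<sigma> \<circ> inv' \<rho>) (unif_measure n) = unif_measure n"
proof -
  have "bij_betw (\<lambda>\<sigma>. \<rho> \<circ> \<sigma> \<circ> inv' \<rho>) (Sym n) (Sym n)"
    by (rule bij_betw_byWitness[where f' = "\<lambda>\<sigma>. inv' \<rho> \<circ> \<sigma> \<circ> \<rho>"])
       (auto simp: fun_eq_iff Sym_inverses[OF assms] assms Sym_comp Sym_inv)
  then show ?thesis
    unfolding unif_measure_def by (rule map_pmf_of_set_bij_betw) (simp_all add: sym_group_finite)
qed

lemma set_unif_measure [simp]: "set_pmf (unif_measure n) = Sym n"
  unfolding unif_measure_def by (simp add: sym_group_finite)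

lemma hamming_conj:
  assumes "\<sigma> \<in> Sym n"
  shows "hamming n (\<sigma> \<circ> a \<circ> inv' \<sigma>) (\<sigma> \<circ> b \<circ> inv' \<sigma>) = hamming n a b"
proof -
  have s: "\<sigma> permutes {1..n}" using assms by (simp add: sym_group_carrier)
  have "{i\<in>{1..n}. (\<sigma> \<circ> a \<circ> inv' \<sigma>) i \<noteq> (\<sigma> \<circ> b \<circ> inv' \<sigma>) i} = \<sigma> ` {i\<in>{1..n}. a i \<noteq> b i}"
    (is "?L = \<sigma> ` ?R")
  proof (intro equalityI subsetI)
    fix i assume "i \<in> ?L"
    then have "inv' \<sigma> i \<in> ?R"
      using permutes_in_image[OF permutes_inv[OF s], of i] by auto
    then have "\<sigma> (inv' \<sigma> i) \<in> \<sigma> ` ?R" by (rule imageI)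
    then show "i \<in> \<sigma> ` ?R" by (simp only: permutes_inverses(1)[OF s])
  next
    fix i assume "i \<in> \<sigma> ` ?R"
    then obtain j where j: "i = \<sigma> j" "j \<in> {1..n}" "a j \<noteq> b j" by blast
    then show "i \<in> ?L"
      using permutes_in_image[OF s, of j] permutes_inverses(2)[OF s, of j] permutes_inj[OF s]
      by (simp add: inj_eq)
  qed
  then show ?thesis
    unfolding hamming_def using permutes_inj_on[OF s] by (simp add: card_image)
qed

lemma hamming_nonneg: "0 \<le> hamming n a b"
  by (simp add: hamming_def)

lemma hamming_le_1: "hamming n a b \<le> 1"
proof -
  have "card {i \<in> {1..n}. a i \<noteq> b i} \<le> n"
    using card_mono[of "{1..n}" "{i \<in> {1..n}. a i \<noteq> b i}"] by fastforce
  then show ?thesis by (simp add: hamming_def divide_simps)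
qed

text \<open>
  If \<open>\<rho>\<close> depends on \<open>\<pi>\<close> and \<open>\<tau>\<close> only and \<open>\<sigma>\<close> is uniform and independent of both, then \<open>\<sigma> \<circ> \<rho>\<close> is uniform
  given \<open>\<pi>\<close> and \<open>\<tau>\<close>. So conjugating \<open>\<pi>\<close> by \<open>\<sigma> \<circ> \<rho>\<close> and \<open>\<tau>\<close> by \<open>\<sigma>\<close> couples the symmetrization with the
  uniform measure, while the distance stays that of the pair matched by \<open>\<rho>\<close>.
\<close>

lemma kantorovich_symmetrization_le:
  assumes \<mu>: "set_pmf \<mu> \<subseteq> Sym n"
    and match: "\<And>\<pi> \<tau>. \<pi> \<in> Sym n \<Longrightarrow> \<tau> \<in> Sym n \<Longrightarrow>
      \<exists>\<rho>\<in>Sym n. hamming n (\<rho> \<circ> \<pi> \<circ> inv' \<rho>) \<tau> \<le> F \<pi> + G \<tau>"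
  shows "kantorovich n (symmetrization n \<mu>) (unif_measure n) \<le>
           measure_pmf.expectation \<mu> F + measure_pmf.expectation (unif_measure n) G"
proof -
  let ?U = "unif_measure n"
  have finS: "finite (Sym n)" by (rule sym_group_finite)
  have "\<forall>\<pi> \<tau>. \<exists>\<rho>. \<pi> \<in> Sym n \<longrightarrow> \<tau> \<in> Sym n \<longrightarrow>
      \<rho>\<in>Sym n \<and> hamming n (\<rho> \<circ> \<pi> \<circ> inv' \<rho>) \<tau> \<le> F \<pi> + G \<tau>"
    using match by blast
  then obtain R where R: "\<And>\<pi> \<tau>. \<pi> \<in> Sym n \<Longrightarrow> \<tau> \<in> Sym n \<Longrightarrow> R \<pi> \<tau> \<in> Sym n"
      "\<And>\<pi> \<tau>. \<pi> \<in> Sym n \<Longrightarrow> \<tau> \<in> Sym n \<Longrightarrow> hamming n (R \<pi> \<tau> \<circ> \<pi> \<circ> inv' (R \<pi> \<tau>)) \<tau> \<le> F \<pi> + G \<tau>"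
    by metis
  define M where "M = pair_pmf (pair_pmf \<mu> ?U) ?U"
  define f where "f = (\<lambda>((\<pi>, \<tau>), \<sigma> :: nat \<Rightarrow> nat). ((\<sigma> \<circ> R \<pi> \<tau>) \<circ> \<pi> \<circ> inv' (\<sigma> \<circ> R \<pi> \<tau>), \<sigma> \<circ> \<tau> \<circ> inv' \<sigma>))"
  have M: "set_pmf M = (set_pmf \<mu> \<times> Sym n) \<times> Sym n"
    unfolding M_def by simp
  have finM: "finite (set_pmf M)"
    unfolding M using finite_subset[OF \<mu> finS] finS by simp
  have fst: "map_pmf fst (map_pmf f M) = symmetrization n \<mu>"
  proof -
    have "map_pmf fst (map_pmf f M) = bind_pmf \<mu> (\<lambda>\<pi>. bind_pmf ?U (\<lambda>\<tau>. bind_pmf ?U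
        (\<lambda>\<sigma>. return_pmf ((\<sigma> \<circ> R \<pi> \<tau>) \<circ> \<pi> \<circ> inv' (\<sigma> \<circ> R \<pi> \<tau>)))))"
      by (simp add: M_def f_def map_pmf_def pair_pmf_def bind_assoc_pmf bind_return_pmf)
    also have "\<dots> = bind_pmf \<mu> (\<lambda>\<pi>. bind_pmf ?U (\<lambda>\<tau>. bind_pmf ?U (\<lambda>\<sigma>. return_pmf (\<sigma> \<circ> \<pi> \<circ> inv' \<sigma>))))"
    proof (rule bind_pmf_cong[OF HOL.refl], rule bind_pmf_cong[OF HOL.refl])
      fix \<pi> \<tau> assume "\<pi> \<in> set_pmf \<mu>" "\<tau> \<in> set_pmf ?U"
      then have "R \<pi> \<tau> \<in> Sym n" using R(1) \<mu> by auto
      from unif_measure_translate[OF this]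
      have "bind_pmf ?U (\<lambda>\<sigma>. return_pmf (\<sigma> \<circ> \<pi> \<circ> inv' \<sigma>)) =
          bind_pmf (map_pmf (\<lambda>\<sigma>. \<sigma> \<circ> R \<pi> \<tau>) ?U) (\<lambda>\<sigma>. return_pmf (\<sigma> \<circ> \<pi> \<circ> inv' \<sigma>))"
        by (simp only:)
      then show "bind_pmf ?U (\<lambda>\<sigma>. return_pmf ((\<sigma> \<circ> R \<pi> \<tau>) \<circ> \<pi> \<circ> inv' (\<sigma> \<circ> R \<pi> \<tau>))) =
          bind_pmf ?U (\<lambda>\<sigma>. return_pmf (\<sigma> \<circ> \<pi> \<circ> inv' \<sigma>))"
        unfolding bind_map_pmf by (rule HOL.sym)
    qed
    also have "\<dots> = symmetrization n \<mu>"
      unfolding symmetrization_def unif_measure_def bind_pmf_const by (rule bind_commute_pmf)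
    finally show ?thesis .
  qed
  have snd: "map_pmf snd (map_pmf f M) = ?U"
  proof -
    have "map_pmf snd (map_pmf f M) =
        bind_pmf ?U (\<lambda>\<tau>. bind_pmf ?U (\<lambda>\<sigma>. return_pmf (\<sigma> \<circ> \<tau> \<circ> inv' \<sigma>)))"
      by (simp add: M_def f_def map_pmf_def pair_pmf_def bind_assoc_pmf bind_return_pmf)
    also have "\<dots> = bind_pmf ?U (\<lambda>\<sigma>. map_pmf (\<lambda>\<tau>. \<sigma> \<circ> \<tau> \<circ> inv' \<sigma>) ?U)"
      unfolding map_pmf_def by (rule bind_commute_pmf)
    also have "\<dots> = bind_pmf ?U (\<lambda>\<sigma>. ?U)"
      by (rule bind_pmf_cong[OF HOL.refl]) (simp add: unif_measure_conj)
    finally show ?thesis by simp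
  qed
  have "set_pmf (map_pmf f M) \<subseteq> Sym n \<times> Sym n"
  proof
    fix z assume "z \<in> set_pmf (map_pmf f M)"
    then obtain \<pi> \<tau> \<sigma> where *: "\<pi> \<in> set_pmf \<mu>" "\<tau> \<in> Sym n" "\<sigma> \<in> Sym n" "z = f ((\<pi>, \<tau>), \<sigma>)"
      unfolding set_map_pmf M by auto
    then have "\<pi> \<in> Sym n" using \<mu> by auto
    with * R(1) show "z \<in> Sym n \<times> Sym n"
      by (simp add: f_def Sym_conj Sym_comp)
  qed
  then have "map_pmf f M \<in> couplings n (symmetrization n \<mu>) ?U"
    unfolding couplings_def using fst snd by simp
  then have "kantorovich n (symmetrization n \<mu>) ?U \<le>
      measure_pmf.expectation (map_pmf f M) (\<lambda>(\<sigma>, \<tau>). hamming n \<sigma> \<tau>)"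
    unfolding kantorovich_def
    by (intro cINF_lower bdd_belowI2[where m = 0] integral_nonneg_AE)
       (simp_all add: hamming_nonneg case_prod_beta)
  also have "\<dots> = measure_pmf.expectation M (\<lambda>z. (\<lambda>(\<sigma>, \<tau>). hamming n \<sigma> \<tau>) (f z))"
    by simp
  also have "\<dots> \<le> measure_pmf.expectation M (\<lambda>z. F (fst (fst z)) + G (snd (fst z)))"
  proof (intro integral_mono_AE integrable_measure_pmf_finite finM, unfold AE_measure_pmf_iff, intro ballI)
    fix z assume "z \<in> set_pmf M"
    then obtain \<pi> \<tau> \<sigma> where *: "\<pi> \<in> set_pmf \<mu>" "\<tau> \<in> Sym n" "\<sigma> \<in> Sym n" "z = ((\<pi>, \<tau>), \<sigma>)"
      unfolding M by auto
    then have p: "\<pi> \<in> Sym n" using \<mu> by auto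
    have "(\<lambda>(\<sigma>, \<tau>). hamming n \<sigma> \<tau>) (f z) = hamming n (R \<pi> \<tau> \<circ> \<pi> \<circ> inv' (R \<pi> \<tau>)) \<tau>"
      using hamming_conj[OF *(3), of "R \<pi> \<tau> \<circ> \<pi> \<circ> inv' (R \<pi> \<tau>)" \<tau>] Sym_inv_comp[OF *(3) R(1)[OF p *(2)]]
      by (simp add: f_def *(4) comp_assoc)
    also have "\<dots> \<le> F \<pi> + G \<tau>" by (rule R(2)[OF p *(2)])
    finally show "(\<lambda>(\<sigma>, \<tau>). hamming n \<sigma> \<tau>) (f z) \<le> F (fst (fst z)) + G (snd (fst z))"
      by (simp add: *(4))
  qed
  also have "\<dots> = measure_pmf.expectation M (\<lambda>z. F (fst (fst z))) + measure_pmf.expectation M (\<lambda>z. G (snd (fst z)))"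
    by (intro Bochner_Integration.integral_add integrable_measure_pmf_finite finM)
  also have "\<dots> = measure_pmf.expectation \<mu> F + measure_pmf.expectation ?U G"
    unfolding M_def
    using expectation_pair_pmf_fst[of "pair_pmf \<mu> ?U" ?U "\<lambda>y. F (fst y)"]
      expectation_pair_pmf_fst[of "pair_pmf \<mu> ?U" ?U "\<lambda>y. G (snd y)"]
    by simp
  finally show ?thesis .
qed

section \<open>Matching two permutations with few short cycles\<close>

text \<open>
  The positions of a list at which its successor is not the image under \<open>p\<close>. The last position
  always counts, which makes the number of breaks subadditive under concatenation.
\<close>

definition breaks :: "('a \<Rightarrow> 'a) \<Rightarrow> 'a list \<Rightarrow> nat set" where
  "breaks p xs = {i. i < length xs \<and> \<not> (Suc i < length xs \<and> p (xs ! i) = xs ! Suc i)}"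

definition short_cycle_points :: "nat \<Rightarrow> ('a \<Rightarrow> 'a) \<Rightarrow> 'a set \<Rightarrow> 'a set" where
  "short_cycle_points K p S = {x \<in> S. \<exists>k\<in>{1..<K}. (p ^^ k) x = x}"

lemma finite_breaks [simp]: "finite (breaks p xs)"
  unfolding breaks_def by simp

lemma card_breaks_append: "card (breaks p (xs @ ys)) \<le> card (breaks p xs) + card (breaks p ys)"
proof -
  have "breaks p (xs @ ys) \<subseteq> breaks p xs \<union> (\<lambda>i. i + length xs) ` breaks p ys"
  proof
    fix i assume i: "i \<in> breaks p (xs @ ys)"
    show "i \<in> breaks p xs \<union> (\<lambda>i. i + length xs) ` breaks p ys"
    proof (cases "i < length xs")
      case True
      with i show ?thesis by (auto simp: breaks_def nth_append)
    next
      case False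
      then have "i - length xs \<in> breaks p ys" using i
        by (auto simp: breaks_def nth_append Suc_diff_le)
      with False show ?thesis by (auto intro!: image_eqI[of _ _ "i - length xs"])
    qed
  qed
  then have "card (breaks p (xs @ ys)) \<le> card (breaks p xs \<union> (\<lambda>i. i + length xs) ` breaks p ys)"
    by (intro card_mono) auto
  also have "\<dots> \<le> card (breaks p xs) + card ((\<lambda>i. i + length xs) ` breaks p ys)"
    by (rule card_Un_le)
  also have "\<dots> \<le> card (breaks p xs) + card (breaks p ys)"
    by (intro add_left_mono card_image_le) simp
  finally show ?thesis .
qed

text \<open>
  Concatenating the cycles of \<open>p\<close> produces one break per cycle. A cycle of length at least \<open>K\<close> is
  paid for by its points at the rate \<open>1 / K\<close>, a shorter one by any one of its points.
\<close>

lemma enumeration_with_few_breaks: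
  assumes "permutation p" "finite S" "p ` S = S" "K > 0"
  shows "\<exists>xs. distinct xs \<and> set xs = S \<and>
    real (card (breaks p xs)) \<le> card S / K + card (short_cycle_points K p S)"
  using assms(2,3)
proof (induction "card S" arbitrary: S rule: less_induct)
  case less
  show ?case
  proof (cases "S = {}")
    case True
    then show ?thesis by (intro exI[of _ "[]"]) (simp add: breaks_def)
  next
    case False
    then obtain x where x: "x \<in> S" by blast
    let ?m = "least_power p x" and ?O = "set (support p x)"
    have m: "(p ^^ ?m) x = x" "?m > 0" using least_power_of_permutation[OF assms(1)] by auto
    have d: "distinct (support p x)" using cycle_of_permutation[OF assms(1)] by blast
    have O: "?O = range (\<lambda>i. (p ^^ i) x)" by (rule support_set[OF assms(1)])
    have inS: "(p ^^ i) x \<in> S" for i by (induction i) (use x less.prems in auto)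
    then have OS: "?O \<subseteq> S" unfolding O by auto
    have len: "length (support p x) = ?m" by simp
    have cO: "card ?O = ?m" using distinct_card[OF d] by simp
    have inj: "inj p" using assms(1) by (simp add: permutation_bijective bij_is_inj)
    have pO: "p ` ?O = ?O"
    proof (rule card_subset_eq)
      show "p ` ?O \<subseteq> ?O" unfolding O by (auto simp: image_iff intro: exI[of _ "Suc _"])
         (metis funpow.simps(2) comp_apply)
      show "card (p ` ?O) = card ?O" using inj by (intro card_image) (auto intro: inj_on_subset)
    qed simp
    have pS: "p ` (S - ?O) = S - ?O"
      using inj less.prems(2) pO by (simp add: image_set_diff)
    have xO: "x \<in> ?O" unfolding O by (auto intro: image_eqI[of _ _ 0])
    have "card (S - ?O) < card S"
      using x xO less.prems(1) by (intro psubset_card_mono) auto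
    from less.hyps[OF this _ pS] less.prems(1) obtain ys where
      ys: "distinct ys" "set ys = S - ?O"
        "real (card (breaks p ys)) \<le> card (S - ?O) / K + card (short_cycle_points K p (S - ?O))"
      by auto
    have "breaks p (support p x) \<subseteq> {?m - 1}"
      using m(2) by (auto simp: breaks_def)
    then have "card (breaks p (support p x)) \<le> 1"
      using card_mono[of "{?m - 1}"] by simp
    then have b: "real (card (breaks p (support p x @ ys))) \<le> 1 + real (card (breaks p ys))"
      using card_breaks_append[of p "support p x" ys] by simp
    have cS: "card S = ?m + card (S - ?O)"
      using card_Diff_subset[OF _ OS] card_mono[OF less.prems(1) OS] cO by simp
    have "card S / K + card (short_cycle_points K p S) \<ge>
        1 + (card (S - ?O) / K + card (short_cycle_points K p (S - ?O)))"
    proof (cases "?m \<ge> K")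
      case True
      then have "1 \<le> ?m / K" using assms(4) by (simp add: divide_simps)
      moreover have "card (short_cycle_points K p (S - ?O)) \<le> card (short_cycle_points K p S)"
        using less.prems(1) by (intro card_mono) (auto simp: short_cycle_points_def)
      ultimately show ?thesis by (simp add: cS add_divide_distrib)
    next
      case False
      then have "x \<in> short_cycle_points K p S - short_cycle_points K p (S - ?O)"
        using x xO m by (auto simp: short_cycle_points_def)
      then have "short_cycle_points K p (S - ?O) \<subset> short_cycle_points K p S"
        by (auto simp: short_cycle_points_def)
      then have "card (short_cycle_points K p (S - ?O)) < card (short_cycle_points K p S)"
        using less.prems(1) by (intro psubset_card_mono) (auto simp: short_cycle_points_def)
      then have "1 + real (card (short_cycle_points K p (S - ?O))) \<le> card (short_cycle_points K p S)"
        by linarith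
      moreover have "real ?m / K \<ge> 0" by simp
      ultimately show ?thesis unfolding cS of_nat_add add_divide_distrib by linarith
    qed
    with b ys(3) have "real (card (breaks p (support p x @ ys))) \<le> card S / K + card (short_cycle_points K p S)"
      by linarith
    with d ys(1,2) OS show ?thesis by (intro exI[of _ "support p x @ ys"]) auto
  qed
qed

text \<open>
  The permutation \<open>\<rho>\<close> carries the enumeration of the points along \<open>\<pi>\<close> to the one along \<open>\<tau>\<close>; the
  conjugate of \<open>\<pi>\<close> then agrees with \<open>\<tau>\<close> wherever neither list has a break.
\<close>

lemma conjugate_close:
  assumes \<pi>: "\<pi> \<in> Sym n" and \<tau>: "\<tau> \<in> Sym n" and K: "K > 0" and n: "n > 0"
  defines "F \<equiv> (\<lambda>\<sigma>. 1 / K + card (short_cycle_points K \<sigma> {1..n}) / n)"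
  shows "\<exists>\<rho>\<in>Sym n. hamming n (\<rho> \<circ> \<pi> \<circ> inv' \<rho>) \<tau> \<le> F \<pi> + F \<tau>"
proof -
  have enum: "\<exists>xs. distinct xs \<and> set xs = {1..n} \<and> real (card (breaks \<sigma> xs)) \<le> n * F \<sigma>"
    if "\<sigma> \<in> Sym n" for \<sigma>
  proof -
    have "n * F \<sigma> = n / K + card (short_cycle_points K \<sigma> {1..n})"
      using n by (simp add: F_def field_simps)
    then show ?thesis
      using enumeration_with_few_breaks[of \<sigma> "{1..n}" K] that K permutes_image[of \<sigma> "{1..n}"]
      by (simp add: sym_group_carrier' sym_group_carrier)
  qed
  from enum[OF \<pi>] obtain xs where
    xs: "distinct xs" "set xs = {1..n}" "real (card (breaks \<pi> xs)) \<le> n * F \<pi>" by blast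
  from enum[OF \<tau>] obtain ys where
    ys: "distinct ys" "set ys = {1..n}" "real (card (breaks \<tau> ys)) \<le> n * F \<tau>" by blast
  have len: "length xs = n" "length ys = n"
    using distinct_card[OF xs(1)] distinct_card[OF ys(1)] xs(2) ys(2) by simp_all
  have bx: "bij_betw ((!) xs) {..<n} {1..n}" and bY: "bij_betw ((!) ys) {..<n} {1..n}"
    using bij_betw_nth[OF xs(1), of "{..<n}"] bij_betw_nth[OF ys(1), of "{..<n}"] len xs(2) ys(2) by auto
  define \<rho> where "\<rho> = (\<lambda>x. if x \<in> {1..n} then ys ! (the_inv_into {..<n} ((!) xs) x) else x)"
  have \<rho>_nth: "\<rho> (xs ! i) = ys ! i" if "i < n" for i
    using that xs(2) len nth_mem[of i xs] bij_betw_imp_inj_on[OF bx]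
    by (auto simp: \<rho>_def the_inv_into_f_f)
  have "bij_betw ((!) ys \<circ> the_inv_into {..<n} ((!) xs)) {1..n} {1..n}"
    using bij_betw_trans[OF bij_betw_the_inv_into[OF bx] bY] .
  then have "bij_betw \<rho> {1..n} {1..n}"
    by (rule bij_betw_cong[THEN iffD1, rotated]) (auto simp: \<rho>_def)
  then have \<rho>: "\<rho> permutes {1..n}"
    by (rule bij_imp_permutes) (auto simp: \<rho>_def)
  have "{y\<in>{1..n}. (\<rho> \<circ> \<pi> \<circ> inv' \<rho>) y \<noteq> \<tau> y} \<subseteq> (!) ys ` (breaks \<pi> xs \<union> breaks \<tau> ys)"
  proof
    fix y assume y: "y \<in> {y\<in>{1..n}. (\<rho> \<circ> \<pi> \<circ> inv' \<rho>) y \<noteq> \<tau> y}"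
    then obtain i where i: "i < n" "y = ys ! i"
      using ys(2) len by (auto simp: in_set_conv_nth simp del: atLeastAtMost_iff dest!: equalityD2[THEN subsetD])
    have "inv' \<rho> y = xs ! i"
      using \<rho>_nth[OF i(1)] i(2) \<rho> by (metis permutes_inverses(2))
    then have "i \<in> breaks \<pi> xs \<union> breaks \<tau> ys"
      using y i len by (auto simp: breaks_def \<rho>_nth)
    with i show "y \<in> (!) ys ` (breaks \<pi> xs \<union> breaks \<tau> ys)" by blast
  qed
  then have "card {y\<in>{1..n}. (\<rho> \<circ> \<pi> \<circ> inv' \<rho>) y \<noteq> \<tau> y} \<le> card ((!) ys ` (breaks \<pi> xs \<union> breaks \<tau> ys))"
    by (intro card_mono) auto
  also have "\<dots> \<le> card (breaks \<pi> xs \<union> breaks \<tau> ys)" by (rule card_image_le) simp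
  also have "\<dots> \<le> card (breaks \<pi> xs) + card (breaks \<tau> ys)" by (rule card_Un_le)
  finally have "real (card {y\<in>{1..n}. (\<rho> \<circ> \<pi> \<circ> inv' \<rho>) y \<noteq> \<tau> y}) \<le> n * (F \<pi> + F \<tau>)"
    using xs(3) ys(3) by (simp add: distrib_left)
  then have "hamming n (\<rho> \<circ> \<pi> \<circ> inv' \<rho>) \<tau> \<le> F \<pi> + F \<tau>"
    using n by (simp add: hamming_def divide_simps mult.commute)
  with \<rho> show ?thesis by (auto simp: sym_group_carrier)
qed

section \<open>The cyclic core of a regular word\<close>

text \<open>
  The condition on two consecutive entries of a word that the constant between them, if it is
  critical, satisfies \<open>P\<close>. Then \<open>successively (turn_ok P)\<close> speaks about all critical constants of a
  word, and \<open>turn_ok P\<close> of its last and first entry about the constant at the cyclic junction.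
\<close>

definition turn_ok :: "('a \<Rightarrow> bool) \<Rightarrow> nat \<times> int \<times> 'a \<Rightarrow> nat \<times> int \<times> 'a \<Rightarrow> bool" where
  "turn_ok P = (\<lambda>(i, e, c) (i', e', c'). i = i' \<and> e = - e' \<longrightarrow> P c)"

definition proper_steps :: "('a, 'b) monoid_scheme \<Rightarrow> nat \<Rightarrow> (nat \<times> int \<times> 'a) list \<Rightarrow> bool" where
  "proper_steps G r ls \<longleftrightarrow> (\<forall>(i, e, c)\<in>set ls. i \<in> {1..r} \<and> e \<in> {1, -1} \<and> c \<in> carrier G)"

definition step_letters :: "(nat \<times> int \<times> 'a) list \<Rightarrow> 'a letter list" where
  "step_letters ls = concat (map (\<lambda>(i, e, c). [Gen i e, Const c]) ls)"

lemma step_letters_simps [simp]: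
  "step_letters [] = []"
  "step_letters ((i, e, c) # ls) = Gen i e # Const c # step_letters ls"
  "step_letters (ls @ ls') = step_letters ls @ step_letters ls'"
  by (simp_all add: step_letters_def)

lemma proper_steps_simps [simp]:
  "proper_steps G r []"
  "proper_steps G r ((i, e, c) # ls) \<longleftrightarrow>
     i \<in> {1..r} \<and> e \<in> {1, -1} \<and> c \<in> carrier G \<and> proper_steps G r ls"
  "proper_steps G r (ls @ ls') \<longleftrightarrow> proper_steps G r ls \<and> proper_steps G r ls'"
  by (simp_all add: proper_steps_def ball_Un)

lemma Const_alphabet [simp]: "Const c \<in> alphabet G r \<longleftrightarrow> c \<in> carrier G"
  by (auto simp: alphabet_def)

lemma Gen_alphabet [simp]: "Gen i e \<in> alphabet G r \<longleftrightarrow> i \<in> {1..r} \<and> e \<in> {1, -1}"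
  by (auto simp: alphabet_def)

lemma step_letters_in [simp]: "proper_steps G r ls \<Longrightarrow> step_letters ls \<in> lists (alphabet G r)"
  by (induction ls) auto

lemma cword_eq: "cword G r (a, ls) \<longleftrightarrow> a \<in> carrier G \<and> proper_steps G r ls"
  by (simp add: cword_def proper_steps_def)

lemma cword_elem_eq: "cword_elem G r (a, ls) = fp_class G r (Const a # step_letters ls)"
  by (simp add: cword_elem_def step_letters_def)

lemma successively_conv_nth:
  "successively R xs \<longleftrightarrow> (\<forall>j. Suc j < length xs \<longrightarrow> R (xs ! j) (xs ! Suc j))"
proof (induction xs)
  case (Cons x xs)
  show ?case
  proof (cases xs)
    case (Cons y ys)
    then show ?thesis using Cons.IH
      by (auto simp: nth_Cons split: nat.splits)
  qed simp
qed simp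

lemma critical_constants_conv:
  "(\<forall>j\<in>critical_indices w. P (word_const w j)) \<longleftrightarrow> successively (turn_ok P) (snd w)"
proof -
  have "(\<forall>j\<in>critical_indices w. P (word_const w j)) \<longleftrightarrow>
      (\<forall>j. Suc j \<in> critical_indices w \<longrightarrow> P (word_const w (Suc j)))"
  proof
    assume *: "\<forall>j. Suc j \<in> critical_indices w \<longrightarrow> P (word_const w (Suc j))"
    show "\<forall>j\<in>critical_indices w. P (word_const w j)"
    proof
      fix j assume j: "j \<in> critical_indices w"
      then have "j \<noteq> 0" by (simp add: critical_indices_def)
      then obtain k where "j = Suc k" by (cases j) auto
      with * j show "P (word_const w j)" by blast
    qed
  qed blast
  also have "\<dots> \<longleftrightarrow> successively (turn_ok P) (snd w)"
    unfolding successively_conv_nth critical_indices_def turn_ok_def word_const_def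
      var_index_def var_sign_def cword_length_def
    by (auto simp: case_prod_beta)
  finally show ?thesis .
qed

lemma reduced_conv: "reduced G w \<longleftrightarrow> successively (turn_ok (\<lambda>c. c \<notin> group_center G)) (snd w)"
  unfolding reduced_def by (rule critical_constants_conv)

lemma fp_cong_context:
  assumes "fp_cong G r u v" "p \<in> lists (alphabet G r)" "s \<in> lists (alphabet G r)"
  shows "fp_cong G r (p @ u @ s) (p @ v @ s)"
  by (intro fp_cong.append fp_cong.refl assms)

lemma fp_cong_const_inverse:
  assumes "group G" "c \<in> carrier G" "d \<in> carrier G" "c \<otimes>\<^bsub>G\<^esub> d = \<one>\<^bsub>G\<^esub>"
  shows "fp_cong G r [Const c, Const d] []"
proof -
  have "fp_cong G r [Const c, Const d] [Const \<one>\<^bsub>G\<^esub>]"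
    using fp_cong.mult[OF assms(2,3), of r] unfolding assms(4) .
  then show ?thesis by (rule fp_cong.trans[OF _ fp_cong.one])
qed

text \<open>
  The induction that strips cancelling ends. The word \<open>W\<close> has been split as \<open>ps\<close>, \<open>ms\<close>, \<open>ss\<close>, where
  \<open>ss\<close> cancels against \<open>ps\<close> (up to the last constant \<open>d\<close> of \<open>ps\<close>), so that the square of \<open>W\<close> is \<open>ps\<close>
  followed by two copies of \<open>ms\<close> and by \<open>ss\<close>. Either this expression is reduced at the junction of
  the two copies, or the last letter of \<open>ms\<close> is the inverse of the first one and the constant
  between them is trivial. In the latter case both are moved to \<open>ps\<close> and \<open>ss\<close>; if nothing were left
  in between, \<open>W\<close> would be conjugate to a constant.

  The list \<open>us\<close> in the conclusion is the reduced expression of the square, which contains \<open>vs\<close> and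
  the turn from the end of \<open>vs\<close> to its beginning; this is how a property of its critical constants
  passes to \<open>vs\<close>.
\<close>

lemma cyclic_core_aux:
  fixes G (structure)
  assumes G: "group G" and centre: "group_center G \<subseteq> {\<one>}"
  shows "\<lbrakk>a \<in> carrier G; proper_steps G r (ps @ ms @ ss); ms \<noteq> []; last ms = (i, e, c);
    d = (if ps = [] then a else snd (snd (last ps)));
    successively (turn_ok (\<lambda>c. c \<notin> group_center G)) (ps @ ms @ ss);
    fp_cong G r (W @ W) (Const a # step_letters (ps @ butlast ms @ [(i, e, c \<otimes> d)] @ ms @ ss));
    h \<in> lists (alphabet G r); h' \<in> lists (alphabet G r); fp_cong G r (h' @ h) [];
    fp_cong G r W (h @ Const d # step_letters ms @ h');
    \<not> conjugate_to_const G r (fp_class G r W)\<rbrakk> \<Longrightarrow>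
   \<exists>us vs h h'. proper_steps G r us \<and> successively (turn_ok (\<lambda>c. c \<notin> group_center G)) us \<and>
     fp_cong G r (W @ W) (Const a # step_letters us) \<and>
     vs \<noteq> [] \<and> length vs \<le> length ms \<and> proper_steps G r vs \<and>
     (\<forall>P. successively (turn_ok P) us \<longrightarrow> successively (turn_ok P) vs \<and> turn_ok P (last vs) (hd vs)) \<and>
     h \<in> lists (alphabet G r) \<and> h' \<in> lists (alphabet G r) \<and> fp_cong G r (h' @ h) [] \<and>
     fp_cong G r W (h @ step_letters vs @ h')"
proof (induction "length ms" arbitrary: ms ps ss i e c d h h' rule: less_induct)
  case less
  interpret group G by (rule G)
  define ms' where "ms' = butlast ms"
  have ms: "ms = ms' @ [(i, e, c)]"
    using append_butlast_last_id[OF less.prems(3)] less.prems(4) by (simp add: ms'_def)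
  have props: "proper_steps G r ps" "proper_steps G r ms'" "proper_steps G r ss"
      "i \<in> {1..r}" "e \<in> {1, -1}" "c \<in> carrier G"
    using less.prems(2) by (auto simp: ms)
  have d: "d \<in> carrier G"
  proof (cases "ps = []")
    case False
    moreover obtain i' e' c' where l: "last ps = (i', e', c')" by (cases "last ps")
    ultimately have "(i', e', c') \<in> set ps" by (metis last_in_set)
    with props(1) have "c' \<in> carrier G" by (auto simp: proper_steps_def)
    with False less.prems(5) l show ?thesis by simp
  qed (use less.prems(1,5) in simp)
  show ?case
  proof (cases "turn_ok (\<lambda>c. c \<notin> group_center G) (i, e, c \<otimes> d) (hd ms)")
    case True
    let ?us = "ps @ ms' @ [(i, e, c \<otimes> d)] @ ms @ ss" and ?vs = "ms' @ [(i, e, c \<otimes> d)]"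
    have last: "turn_ok P s (i, e, c) \<longleftrightarrow> turn_ok P s (i, e, c \<otimes> d)" for P s
      by (auto simp: turn_ok_def split: prod.splits)
    have "successively (turn_ok (\<lambda>c. c \<notin> group_center G)) ?us"
      using less.prems(6) True
      by (cases ms'; cases "ps = []")
         (auto simp: ms successively_append_iff successively_Cons last hd_append split: if_splits)
    moreover have "\<forall>P. successively (turn_ok P) ?us \<longrightarrow>
        successively (turn_ok P) ?vs \<and> turn_ok P (last ?vs) (hd ?vs)"
      by (cases ms'; cases "ps = []")
         (auto simp: ms successively_append_iff successively_Cons last hd_append split: if_splits)
    moreover have "fp_cong G r ((Const (inv d) # h') @ (h @ [Const d])) []"
    proof -
      have "fp_cong G r ([Const (inv d)] @ (h' @ h) @ [Const d]) ([Const (inv d)] @ [] @ [Const d])"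
        using d by (intro fp_cong_context less.prems(10)) auto
      then have "fp_cong G r ((Const (inv d) # h') @ (h @ [Const d])) [Const (inv d), Const d]" by simp
      moreover have "fp_cong G r [Const (inv d), Const d] []"
        using d by (intro fp_cong_const_inverse G) auto
      ultimately show ?thesis by (rule fp_cong.trans)
    qed
    moreover have "fp_cong G r W ((h @ [Const d]) @ step_letters ?vs @ (Const (inv d) # h'))"
    proof -
      have "fp_cong G r [Const (c \<otimes> d), Const (inv d)] [Const (c \<otimes> d \<otimes> inv d)]"
        using props(6) d by (intro fp_cong.mult) auto
      then have "fp_cong G r [Const (c \<otimes> d), Const (inv d)] [Const c]"
        using props(6) d by (simp add: m_assoc)
      then have "fp_cong G r ((h @ Const d # step_letters ms' @ [Gen i e]) @ [Const (c \<otimes> d), Const (inv d)] @ h')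
          ((h @ Const d # step_letters ms' @ [Gen i e]) @ [Const c] @ h')"
        using props d less.prems(8,9) by (intro fp_cong_context) auto
      then have "fp_cong G r ((h @ [Const d]) @ step_letters ?vs @ (Const (inv d) # h'))
          (h @ Const d # step_letters ms @ h')"
        by (simp add: ms)
      then show ?thesis by (rule fp_cong.trans[OF less.prems(11) fp_cong.sym])
    qed
    ultimately show ?thesis
      using less.prems(7-9) props d
      by (intro exI[of _ ?us] exI[of _ ?vs] exI[of _ "h @ [Const d]"] exI[of _ "Const (inv d) # h'"])
         (auto simp: ms)
  next
    case False
    obtain i1 e1 c1 where hd: "hd ms = (i1, e1, c1)" by (cases "hd ms")
    from False have i1: "i1 = i" "e1 = - e" and "c \<otimes> d \<in> group_center G"
      by (auto simp: hd turn_ok_def)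
    then have cd: "c \<otimes> d = \<one>" using centre by auto
    have "ms' \<noteq> []" using hd i1 props(5) by (auto simp: ms)
    then obtain ms'' where ms': "ms' = (i, - e, c1) # ms''"
      using hd i1 by (cases ms') (auto simp: ms)
    have c1: "c1 \<in> carrier G" "proper_steps G r ms''" using props(2) by (auto simp: ms')
    let ?h = "h @ [Const d, Gen i (- e)]" and ?h' = "[Gen i e, Const c] @ h'"
    have hlists: "?h \<in> lists (alphabet G r)" "?h' \<in> lists (alphabet G r)"
      using less.prems(8,9) d props by auto
    have hinv: "fp_cong G r (?h' @ ?h) []"
    proof -
      have "fp_cong G r ([Gen i e, Const c] @ (h' @ h) @ [Const d, Gen i (- e)])
          ([Gen i e, Const c] @ [] @ [Const d, Gen i (- e)])"
        using d props by (intro fp_cong_context less.prems(10)) auto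
      then have "fp_cong G r (?h' @ ?h) [Gen i e, Const c, Const d, Gen i (- e)]" by simp
      moreover have "fp_cong G r ([Gen i e] @ [Const c, Const d] @ [Gen i (- e)]) ([Gen i e] @ [] @ [Gen i (- e)])"
        using props d by (intro fp_cong_context fp_cong_const_inverse G cd) auto
      then have "fp_cong G r [Gen i e, Const c, Const d, Gen i (- e)] [Gen i e, Gen i (- e)]" by simp
      moreover have "fp_cong G r [Gen i e, Gen i (- e)] []"
        using props by (intro fp_cong.cancel) auto
      ultimately show ?thesis by (blast intro: fp_cong.trans)
    qed
    have W: "fp_cong G r W (?h @ Const c1 # step_letters ms'' @ ?h')"
      using less.prems(11) by (simp add: ms ms')
    show ?thesis
    proof (cases "ms'' = []")
      case True
      let ?F = "free_prod G r"
      interpret F: group ?F by (rule free_prod_group[OF G])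
      have car: "fp_class G r ?h \<in> carrier ?F" "fp_class G r ?h' \<in> carrier ?F"
        using hlists unfolding free_prod_carrier by blast+
      have "fp_class G r ?h' \<otimes>\<^bsub>?F\<^esub> fp_class G r ?h = \<one>\<^bsub>?F\<^esub>"
        unfolding free_prod_mult[OF G hlists(2,1)] free_prod_one by (rule fp_class_eq[OF G hinv])
      then have inv: "inv\<^bsub>?F\<^esub> (fp_class G r ?h) = fp_class G r ?h'"
        using car by (rule F.inv_equality)
      have "fp_class G r W = fp_class G r ((?h @ [Const c1]) @ ?h')"
        using W True by (intro fp_class_eq[OF G]) simp
      also have "\<dots> = fp_class G r ?h \<otimes>\<^bsub>?F\<^esub> const_elem G r c1 \<otimes>\<^bsub>?F\<^esub> inv\<^bsub>?F\<^esub> (fp_class G r ?h)"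
      proof -
        have l: "[Const c1] \<in> lists (alphabet G r)" "?h @ [Const c1] \<in> lists (alphabet G r)"
          using c1 hlists(1) by auto
        show ?thesis
          unfolding inv const_elem_def free_prod_mult[OF G hlists(1) l(1)] free_prod_mult[OF G l(2) hlists(2)]
          by (rule HOL.refl)
      qed
      finally have "conjugate_to_const G r (fp_class G r W)"
        unfolding conjugate_to_const_def using car(1) c1(1) by blast
      with less.prems(12) show ?thesis by blast
    next
      case False
      obtain i3 e3 c3 where last: "last ms'' = (i3, e3, c3)" by (cases "last ms''")
      define m3 where "m3 = butlast ms''"
      have ms'': "ms'' = m3 @ [(i3, e3, c3)]"
        using append_butlast_last_id[OF False] last by (simp add: m3_def)
      have p3: "proper_steps G r m3" "i3 \<in> {1..r}" "e3 \<in> {1, -1}" "c3 \<in> carrier G"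
        using c1(2) by (auto simp: ms'')
      have "fp_cong G r ([Const c3, Gen i e, Const \<one>, Gen i (- e), Const c1]) [Const (c3 \<otimes> c1)]"
      proof -
        have "fp_cong G r ([Const c3, Gen i e] @ [Const \<one>] @ [Gen i (- e), Const c1])
            ([Const c3, Gen i e] @ [] @ [Gen i (- e), Const c1])"
          using p3 props c1 by (intro fp_cong_context fp_cong.one) auto
        then have "fp_cong G r [Const c3, Gen i e, Const \<one>, Gen i (- e), Const c1]
            [Const c3, Gen i e, Gen i (- e), Const c1]" by simp
        moreover have "fp_cong G r ([Const c3] @ [Gen i e, Gen i (- e)] @ [Const c1]) ([Const c3] @ [] @ [Const c1])"
          using p3 props c1 by (intro fp_cong_context fp_cong.cancel) auto
        then have "fp_cong G r [Const c3, Gen i e, Gen i (- e), Const c1] [Const c3, Const c1]" by simp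
        moreover have "fp_cong G r [Const c3, Const c1] [Const (c3 \<otimes> c1)]"
          using p3 c1 by (intro fp_cong.mult) auto
        ultimately show ?thesis by (blast intro: fp_cong.trans)
      qed
      then have "fp_cong G r
          ((Const a # step_letters (ps @ (i, - e, c1) # m3) @ [Gen i3 e3]) @
             [Const c3, Gen i e, Const \<one>, Gen i (- e), Const c1] @ step_letters (ms'' @ (i, e, c) # ss))
          ((Const a # step_letters (ps @ (i, - e, c1) # m3) @ [Gen i3 e3]) @
             [Const (c3 \<otimes> c1)] @ step_letters (ms'' @ (i, e, c) # ss))"
        using p3 props c1 less.prems(1) by (intro fp_cong_context) auto
      then have "fp_cong G r (Const a # step_letters (ps @ butlast ms @ [(i, e, c \<otimes> d)] @ ms @ ss))
          (Const a # step_letters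
            ((ps @ [(i, - e, c1)]) @ butlast ms'' @ [(i3, e3, c3 \<otimes> c1)] @ ms'' @ (i, e, c) # ss))"
        by (simp add: ms ms' ms'' cd butlast_append)
      then have sq: "fp_cong G r (W @ W) (Const a # step_letters
          ((ps @ [(i, - e, c1)]) @ butlast ms'' @ [(i3, e3, c3 \<otimes> c1)] @ ms'' @ (i, e, c) # ss))"
        by (rule fp_cong.trans[OF less.prems(7)])
      have "\<exists>us vs h h'. proper_steps G r us \<and> successively (turn_ok (\<lambda>c. c \<notin> group_center G)) us \<and>
         fp_cong G r (W @ W) (Const a # step_letters us) \<and>
         vs \<noteq> [] \<and> length vs \<le> length ms'' \<and> proper_steps G r vs \<and>
         (\<forall>P. successively (turn_ok P) us \<longrightarrow> successively (turn_ok P) vs \<and> turn_ok P (last vs) (hd vs)) \<and>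
         h \<in> lists (alphabet G r) \<and> h' \<in> lists (alphabet G r) \<and> fp_cong G r (h' @ h) [] \<and>
         fp_cong G r W (h @ step_letters vs @ h')"
      proof (rule less.hyps[OF _ less.prems(1) _ False last _ _ sq hlists hinv W less.prems(12)])
        show "length ms'' < length ms" by (simp add: ms ms')
        show "proper_steps G r ((ps @ [(i, - e, c1)]) @ ms'' @ (i, e, c) # ss)"
          using less.prems(2) by (simp add: ms ms')
        show "successively (turn_ok (\<lambda>c. c \<notin> group_center G)) ((ps @ [(i, - e, c1)]) @ ms'' @ (i, e, c) # ss)"
          using less.prems(6) by (simp add: ms ms')
      qed simp
      moreover have "length ms'' \<le> length ms" by (simp add: ms ms')
      ultimately show ?thesis by (meson le_trans)
    qed
  qed
qed


text \<open>
  The word \<open>vs\<close> is a conjugate of \<open>w\<close> all powers of which are reduced as they stand: whatever holds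
  for the critical constants of a reduced form of the square of \<open>w\<close> holds for all critical
  constants of \<open>vs\<close>, including those at the junction of two copies.
\<close>

lemma cyclic_core:
  assumes G: "group G" and centre: "group_center G \<subseteq> {\<one>\<^bsub>G\<^esub>}"
    and w: "cword G r w" "reduced G w" "\<not> conjugate_to_const G r (cword_elem G r w)"
      "snd w \<noteq> []"
  obtains u vs h h' where
    "reduced_form G r u (cword_elem G r w [^]\<^bsub>free_prod G r\<^esub> (2::nat))"
    "vs \<noteq> []" "length vs \<le> cword_length w" "proper_steps G r vs"
    "\<And>P. (\<forall>j\<in>critical_indices u. P (word_const u j)) \<Longrightarrow>
       successively (turn_ok P) vs \<and> turn_ok P (last vs) (hd vs)"
    "h \<in> lists (alphabet G r)" "h' \<in> lists (alphabet G r)" "fp_cong G r (h' @ h) []"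
    "cword_elem G r w = fp_class G r (h @ step_letters vs @ h')"
proof -
  interpret group G by (rule G)
  obtain a ms where w_eq: "w = (a, ms)" by (cases w)
  let ?W = "Const a # step_letters ms"
  have a: "a \<in> carrier G" and ms: "proper_steps G r ms" "ms \<noteq> []"
    using w(1,4) by (simp_all add: w_eq cword_eq)
  obtain i e c where last: "last ms = (i, e, c)" by (cases "last ms")
  define ms' where "ms' = butlast ms"
  have ms_eq: "ms = ms' @ [(i, e, c)]"
    using append_butlast_last_id[OF ms(2)] last by (simp add: ms'_def)
  have c: "c \<in> carrier G" "proper_steps G r ms'" "i \<in> {1..r}" "e \<in> {1, -1}"
    using ms(1) by (simp_all add: ms_eq)
  have "fp_cong G r ((Const a # step_letters ms' @ [Gen i e]) @ [Const c, Const a] @ step_letters ms)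
      ((Const a # step_letters ms' @ [Gen i e]) @ [Const (c \<otimes>\<^bsub>G\<^esub> a)] @ step_letters ms)"
    using a c ms(1) by (intro fp_cong_context fp_cong.mult) auto
  then have sq: "fp_cong G r (?W @ ?W)
      (Const a # step_letters ([] @ butlast ms @ [(i, e, c \<otimes>\<^bsub>G\<^esub> a)] @ ms @ []))"
    by (simp add: ms_eq)
  have W: "?W \<in> lists (alphabet G r)" using a ms(1) by simp
  have "successively (turn_ok (\<lambda>c. c \<notin> group_center G)) ms"
    using w(2) by (simp add: reduced_conv w_eq)
  then have "\<exists>us vs h h'. proper_steps G r us \<and> successively (turn_ok (\<lambda>c. c \<notin> group_center G)) us \<and>
     fp_cong G r (?W @ ?W) (Const a # step_letters us) \<and>
     vs \<noteq> [] \<and> length vs \<le> length ms \<and> proper_steps G r vs \<and>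
     (\<forall>P. successively (turn_ok P) us \<longrightarrow> successively (turn_ok P) vs \<and> turn_ok P (last vs) (hd vs)) \<and>
     h \<in> lists (alphabet G r) \<and> h' \<in> lists (alphabet G r) \<and> fp_cong G r (h' @ h) [] \<and>
     fp_cong G r ?W (h @ step_letters vs @ h')"
    by (intro cyclic_core_aux[OF G centre a _ ms(2) last, where ps = "[]" and ss = "[]" and d = a and h = "[]" and h' = "[]"])
       (use ms W w(3) sq fp_cong.refl[OF W] fp_cong.refl[of "[]" G r] in \<open>auto simp: w_eq cword_elem_eq\<close>)
  then obtain us vs h h' where
    us: "proper_steps G r us" "successively (turn_ok (\<lambda>c. c \<notin> group_center G)) us"
      "fp_cong G r (?W @ ?W) (Const a # step_letters us)"
    and vs: "vs \<noteq> []" "length vs \<le> length ms" "proper_steps G r vs"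
      "\<And>P. successively (turn_ok P) us \<Longrightarrow> successively (turn_ok P) vs \<and> turn_ok P (last vs) (hd vs)"
    and h: "h \<in> lists (alphabet G r)" "h' \<in> lists (alphabet G r)" "fp_cong G r (h' @ h) []"
      "fp_cong G r ?W (h @ step_letters vs @ h')"
    by blast
  interpret F: group "free_prod G r" by (rule free_prod_group[OF G])
  have car: "cword_elem G r w \<in> carrier (free_prod G r)"
    unfolding free_prod_carrier w_eq cword_elem_eq using W by blast
  have "cword_elem G r w [^]\<^bsub>free_prod G r\<^esub> (2::nat) =
      cword_elem G r w \<otimes>\<^bsub>free_prod G r\<^esub> cword_elem G r w"
    using car by (simp add: numeral_2_eq_2)
  also have "\<dots> = fp_class G r (?W @ ?W)"
    unfolding w_eq cword_elem_eq by (rule free_prod_mult[OF G W W])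
  also have "\<dots> = cword_elem G r (a, us)"
    unfolding cword_elem_eq by (rule fp_class_eq[OF G us(3)])
  finally have "reduced_form G r (a, us) (cword_elem G r w [^]\<^bsub>free_prod G r\<^esub> (2::nat))"
    using a us(1,2) by (simp add: reduced_form_def reduced_conv cword_eq)
  moreover have "cword_elem G r w = fp_class G r (h @ step_letters vs @ h')"
    unfolding w_eq cword_elem_eq by (rule fp_class_eq[OF G h(4)])
  moreover have "length vs \<le> cword_length w" using vs(2) by (simp add: w_eq cword_length_def)
  moreover have "successively (turn_ok P) vs \<and> turn_ok P (last vs) (hd vs)"
    if "\<forall>j\<in>critical_indices (a, us). P (word_const (a, us) j)" for P
    by (rule vs(4)) (use that critical_constants_conv[of "(a, us)" P] in simp)
  ultimately show ?thesis
    using vs(1,3) h(1-3) by (intro that)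
qed

lemma center_sym_group:
  assumes "n \<ge> 3" shows "group_center (sym_group n) \<subseteq> {\<one>\<^bsub>sym_group n\<^esub>}"
proof
  fix z assume z: "z \<in> group_center (sym_group n)"
  have zp: "z permutes {1..n}" using z by (simp add: group_center_def sym_group_carrier)
  have "z a = a" for a
  proof (rule ccontr)
    assume a: "z a \<noteq> a"
    then have "a \<in> {1..n}" using zp by (meson permutes_not_in)
    then have za: "z a \<in> {1..n}" using permutes_in_image[OF zp] by blast
    have "\<not> {1..n} \<subseteq> {a, z a}"
      using card_mono[of "{a, z a}" "{1..n}"] assms a by auto
    then obtain b where b: "b \<in> {1..n}" "b \<noteq> a" "b \<noteq> z a" by blast
    let ?t = "Transposition.transpose (z a) b"
    have "?t \<in> carrier (sym_group n)"
      using za b by (simp add: sym_group_carrier permutes_swap_id)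
    then have "z \<circ> ?t = ?t \<circ> z"
      using z unfolding group_center_def sym_group_mult by blast
    then have "z (?t a) = ?t (z a)" by (metis comp_apply)
    then show False using a b by (simp add: transpose_def)
  qed
  then show "z \<in> {\<one>\<^bsub>sym_group n\<^esub>}" by (auto simp: sym_group_one)
qed

section \<open>Revealing random permutations along the trajectory of a point\<close>

type_synonym step = "nat \<times> int \<times> (nat \<Rightarrow> nat)"

definition act :: "(nat \<Rightarrow> nat \<Rightarrow> nat) \<Rightarrow> nat \<Rightarrow> int \<Rightarrow> nat \<Rightarrow> nat" where
  "act g i e = (if e = 1 then g i else inv' (g i))"

text \<open>
  A word acts here from left to right, each entry \<open>(i, e, c)\<close> first by its letter and then by its
  constant. This is the order in which the trajectory of a point meets the letters.
\<close>

primrec run :: "(nat \<Rightarrow> nat \<Rightarrow> nat) \<Rightarrow> step list \<Rightarrow> nat \<Rightarrow> nat" where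
  "run g [] p = p"
| "run g (s # ls) p = (case s of (i, e, c) \<Rightarrow> run g ls (c (act g i e p)))"

primrec returns :: "(nat \<Rightarrow> nat \<Rightarrow> nat) \<Rightarrow> nat \<Rightarrow> step list \<Rightarrow> nat \<Rightarrow> bool" where
  "returns g x [] p \<longleftrightarrow> False"
| "returns g x (s # ls) p \<longleftrightarrow>
     (case s of (i, e, c) \<Rightarrow> c (act g i e p) = x \<or> returns g x ls (c (act g i e p)))"

text \<open>
  A triple \<open>(i, a, b)\<close> records that \<open>g i\<close> is known to map \<open>a\<close> to \<open>b\<close>. With this knowledge \<open>D\<close>, the set
  \<open>used D i e\<close> consists of the points where the letter \<open>x_i\<close> with exponent \<open>e\<close> has a known value, and
  \<open>used D i (- e)\<close> of the known values.
\<close>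

definition used :: "(nat \<times> nat \<times> nat) set \<Rightarrow> nat \<Rightarrow> int \<Rightarrow> nat set" where
  "used D i e = (if e = 1 then {a. \<exists>b. (i, a, b) \<in> D} else {b. \<exists>a. (i, a, b) \<in> D})"

definition constraint :: "nat \<Rightarrow> int \<Rightarrow> nat \<Rightarrow> nat \<Rightarrow> nat \<times> nat \<times> nat" where
  "constraint i e p q = (if e = 1 then (i, p, q) else (i, q, p))"

definition consistent :: "nat \<Rightarrow> nat \<Rightarrow> (nat \<times> nat \<times> nat) set \<Rightarrow> (nat \<Rightarrow> nat \<Rightarrow> nat) set" where
  "consistent n r D = {g \<in> {1..r} \<rightarrow>\<^sub>E Sym n. \<forall>(i, a, b)\<in>D. g i a = b}"

lemma finite_consistent [simp]: "finite (consistent n r D)"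
  by (rule finite_subset[of _ "{1..r} \<rightarrow>\<^sub>E Sym n"])
     (auto simp: consistent_def intro!: finite_PiE sym_group_finite)

lemma used_eq_image: "used D i e = (\<lambda>(j, a, b). if e = 1 then a else b) ` {z \<in> D. fst z = i}"
  by (cases "e = 1") (auto simp: used_def intro: rev_image_eqI)

lemma finite_used: "finite D \<Longrightarrow> finite (used D i e)"
  by (simp add: used_eq_image)

lemma card_used:
  assumes "finite D" shows "card (used D i e) \<le> card D"
proof -
  have "card (used D i e) \<le> card {z \<in> D. fst z = i}"
    unfolding used_eq_image by (rule card_image_le) (simp add: assms)
  also have "\<dots> \<le> card D" by (rule card_mono) (auto simp: assms)
  finally show ?thesis .
qed

lemma act_in: 
  assumes "g \<in> {1..r} \<rightarrow>\<^sub>E Sym n" "i \<in> {1..r}" "p \<in> {1..n}"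
  shows "act g i e p \<in> {1..n}"
proof -
  have "g i permutes {1..n}" using assms(1,2) by (auto simp: sym_group_carrier)
  then show ?thesis
    using permutes_in_image[of "g i" "{1..n}" p] permutes_in_image[OF permutes_inv, of "g i" "{1..n}" p] assms(3)
    unfolding act_def by auto
qed

text \<open>
  Any two unused values are equally likely: composing \<open>g i\<close> with the transposition of \<open>q\<close> and \<open>q'\<close>
  leaves all recorded values in place and exchanges the two.
\<close>

lemma card_consistent_le:
  assumes i: "i \<in> {1..r}" and e: "e \<in> {1, -1}"
    and q: "q \<in> {1..n} - used D i (- e)" and q': "q' \<in> {1..n} - used D i (- e)"
  shows "card (consistent n r (insert (constraint i e p q) D)) \<le>
         card (consistent n r (insert (constraint i e p q') D))"
proof -
  let ?t = "Transposition.transpose q q'"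
  \<comment> \<open>For \<open>e = 1\<close> the values are images of \<open>g i\<close>, for \<open>e = -1\<close> they are its arguments.\<close>
  define \<Phi> where "\<Phi> = (\<lambda>h. if e = 1 then ?t \<circ> h else h \<circ> ?t)"
  have t: "?t permutes {1..n}" using q q' by (intro permutes_swap_id) auto
  have \<Phi>\<Phi>: "\<Phi> (\<Phi> h) = h" for h
    by (auto simp: \<Phi>_def fun_eq_iff)
  have \<Phi>S: "\<Phi> h \<in> Sym n" if "h \<in> Sym n" for h
    using that t by (auto simp: \<Phi>_def sym_group_carrier permutes_compose)
  show ?thesis
  proof (rule card_inj_on_le[where f = "\<lambda>g. g(i := \<Phi> (g i))"])
    show "inj_on (\<lambda>g. g(i := \<Phi> (g i))) (consistent n r (insert (constraint i e p q) D))"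
      by (rule inj_on_inverseI[where g = "\<lambda>g. g(i := \<Phi> (g i))"]) (simp add: \<Phi>\<Phi>)
    show "(\<lambda>g. g(i := \<Phi> (g i))) ` consistent n r (insert (constraint i e p q) D)
        \<subseteq> consistent n r (insert (constraint i e p q') D)"
    proof (intro image_subsetI)
      fix g assume g: "g \<in> consistent n r (insert (constraint i e p q) D)"
      then have gS: "g \<in> {1..r} \<rightarrow>\<^sub>E Sym n" and gD: "\<And>j a b. (j, a, b) \<in> D \<Longrightarrow> g j a = b"
        and gq: "if e = 1 then g i p = q else g i q = p"
        by (auto simp: consistent_def constraint_def split: if_splits)
      have "g(i := \<Phi> (g i)) \<in> {1..r} \<rightarrow>\<^sub>E Sym n"
        using gS \<Phi>S i by (auto simp: PiE_iff extensional_def)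
      moreover have "(g(i := \<Phi> (g i))) j a = b" if "(j, a, b) \<in> D" for j a b
      proof (cases "j = i")
        case True
        with that q q' e have "if e = 1 then b \<noteq> q \<and> b \<noteq> q' else a \<noteq> q \<and> a \<noteq> q'"
          by (auto simp: used_def)
        then show ?thesis using gD[OF that] True by (auto simp: \<Phi>_def split: if_splits)
      qed (use gD[OF that] in simp)
      moreover have "if e = 1 then (g(i := \<Phi> (g i))) i p = q' else (g(i := \<Phi> (g i))) i q' = p"
        using gq by (auto simp: \<Phi>_def)
      ultimately show "g(i := \<Phi> (g i)) \<in> consistent n r (insert (constraint i e p q') D)"
        unfolding consistent_def constraint_def by (auto split: if_splits)
    qed
  qed simp
qed

lemma act_constraint:
  assumes "g \<in> {1..r} \<rightarrow>\<^sub>E Sym n" "i \<in> {1..r}" "e \<in> {1, -1}" "constraint i e p q = (j, a, b)"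
  shows "g j a = b \<longleftrightarrow> act g i e p = q"
proof -
  have "g i permutes {1..n}" using assms(1,2) by (auto simp: sym_group_carrier)
  then show ?thesis using assms(3,4) permutes_inverses[of "g i" "{1..n}"]
    by (auto simp: constraint_def act_def)
qed

lemma consistent_insert:
  assumes "i \<in> {1..r}" "e \<in> {1, -1}"
  shows "consistent n r (insert (constraint i e p q) D) = {g \<in> consistent n r D. act g i e p = q}"
proof -
  obtain j a b where c: "constraint i e p q = (j, a, b)" by (cases "constraint i e p q")
  have "(\<forall>(j', a', b')\<in>insert (j, a, b) D. g j' a' = b') \<longleftrightarrow>
      act g i e p = q \<and> (\<forall>(j', a', b')\<in>D. g j' a' = b')" if "g \<in> {1..r} \<rightarrow>\<^sub>E Sym n" for g
    using act_constraint[OF that assms c] by simp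
  then show ?thesis
    unfolding consistent_def c by (intro Collect_cong) (simp only: mem_Collect_eq, metis)
qed

lemma act_unused:
  assumes g: "g \<in> consistent n r D" and i: "i \<in> {1..r}" and p: "p \<in> {1..n}" "p \<notin> used D i e" and e: "e \<in> {1, -1}"
  shows "act g i e p \<in> {1..n} - used D i (- e)"
proof -
  have gS: "g \<in> {1..r} \<rightarrow>\<^sub>E Sym n" using g by (simp add: consistent_def)
  then have gi: "g i permutes {1..n}" using i by (auto simp: sym_group_carrier)
  have "act g i e p \<notin> used D i (- e)"
  proof
    assume "act g i e p \<in> used D i (- e)"
    with e obtain a b where ab: "(i, a, b) \<in> D" "act g i e p = (if e = 1 then b else a)"
      by (auto simp: used_def split: if_splits)
    with g have "g i a = b" by (auto simp: consistent_def)
    with ab(2) e have "p = (if e = 1 then a else b)"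
      using gi permutes_inverses[OF gi] by (auto simp: act_def split: if_splits) (metis)+
    with ab(1) p(2) show False by (auto simp: used_def split: if_splits)
  qed
  with act_in[OF gS i p(1)] show ?thesis by blast
qed

text \<open>
  There are at least \<open>n - card D\<close> unused values, all equally likely, so each of them has
  probability at most \<open>1 / (n - card D)\<close>.
\<close>

lemma card_consistent_insert:
  assumes i: "i \<in> {1..r}" and e: "e \<in> {1, -1}" and q: "q \<in> {1..n} - used D i (- e)" and D: "finite D"
  shows "(n - card D) * card (consistent n r (insert (constraint i e p q) D)) \<le> card (consistent n r D)"
proof -
  let ?Q = "{1..n} - used D i (- e)"
  let ?N = "\<lambda>q. consistent n r (insert (constraint i e p q) D)"
  have "n - card D \<le> card ?Q"
    using diff_card_le_card_Diff[of "used D i (- e)" "{1..n}"] finite_used[OF D, of i "- e"] card_used[OF D, of i "- e"] by simp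
  then have "(n - card D) * card (?N q) \<le> card ?Q * card (?N q)" by simp
  also have "\<dots> = (\<Sum>q'\<in>?Q. card (?N q))" by simp
  also have "\<dots> \<le> (\<Sum>q'\<in>?Q. card (?N q'))"
    by (intro sum_mono card_consistent_le i e q)
  also have "\<dots> = card (\<Union>q'\<in>?Q. ?N q')"
    by (rule card_UN_disjoint[symmetric]) (auto simp: consistent_insert[OF i e])
  also have "\<dots> \<le> card (consistent n r D)"
    by (rule card_mono) (auto simp: consistent_insert[OF i e])
  finally show ?thesis .
qed

definition fresh :: "(nat \<times> nat \<times> nat) set \<Rightarrow> step list \<Rightarrow> nat \<Rightarrow> bool" where
  "fresh D ls p \<longleftrightarrow> (case ls of [] \<Rightarrow> True | (i, e, c) # _ \<Rightarrow> p \<notin> used D i e)"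

text \<open>
  The image of a bad value \<open>q\<close> under \<open>c\<close> is \<open>x\<close> or a point at which the next letter has been queried.
  The query just made contributes \<open>p\<close> if the next letter repeats the current one. If the next
  letter is the inverse of the current one, it contributes \<open>q\<close> itself; that would force \<open>c q = q\<close>,
  which the condition on critical constants rules out.
\<close>

lemma card_bad_values:
  assumes D: "finite D" and c: "c \<in> Sym n" and turn: "ls \<noteq> [] \<Longrightarrow> turn_ok (fixed_point_free n) (i, e, c) (hd ls)"
    and e: "e \<in> {1, -1}" and ls: "proper_steps (sym_group n) r ls"
  shows "card {q \<in> {1..n} - U. c q = x \<or> \<not> fresh (insert (constraint i e p q) D) ls (c q)} \<le> card D + 2"
    (is "card ?B \<le> _")
proof -
  have cp: "c permutes {1..n}" using c by (simp add: sym_group_carrier)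
  define V where "V = (case ls of [] \<Rightarrow> {} | (i', e', c') # _ \<Rightarrow> insert p (used D i' e'))"
  have V: "card V \<le> card D + 1" "finite V"
  proof -
    have "card (insert p (used D i' e')) \<le> card D + 1" for i' e'
      using card_insert_le_m1[of "card D + 1" "used D i' e'" p] card_used[OF D, of i' e'] 
      by simp
    then show "card V \<le> card D + 1" "finite V"
      by (auto simp: V_def finite_used[OF D] split: list.splits)
  qed
  have "?B \<subseteq> inv' c ` insert x V"
  proof
    fix q assume q: "q \<in> ?B"
    have "c q \<in> insert x V"
    proof (cases "c q = x")
      case False
      with q have nf: "\<not> fresh (insert (constraint i e p q) D) ls (c q)" by simp
      then obtain i' e' c' ls' where l: "ls = (i', e', c') # ls'"
        by (auto simp: fresh_def split: list.splits)
      with nf have u: "c q \<in> used (insert (constraint i e p q) D) i' e'" by (simp add: fresh_def)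
      have e': "e' \<in> {1, -1}" using ls l by (simp add: proper_steps_def)
      have "c q \<in> insert p (used D i' e')"
      proof (cases "i = i' \<and> e = - e'")
        case True
        then have "c q \<noteq> q" using turn l q by (simp add: turn_ok_def fixed_point_free_def)
        then show ?thesis using u True e e' by (auto simp: used_def constraint_def split: if_splits)
      next
        case False
        then show ?thesis using u e e' by (auto simp: used_def constraint_def split: if_splits)
      qed
      then show ?thesis by (simp add: V_def l)
    qed simp
    then show "q \<in> inv' c ` insert x V" using permutes_inverses(2)[OF cp, of q]
      by (metis image_eqI)
  qed
  then have "card ?B \<le> card (inv' c ` insert x V)" by (intro card_mono) (simp_all add: V)
  also have "\<dots> \<le> card (insert x V)" by (rule card_image_le) (simp add: V)
  also have "\<dots> \<le> card D + 2" using V card_insert_le_m1[of "card D + 2" V x] by simp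
  finally show ?thesis .
qed

text \<open>
  Induction along the word: the value revealed by the first letter either is bad, which happens
  with probability at most \<open>(L + 1) / (n - L)\<close>, or leads to a point at which the next letter has
  not been queried, and then the induction hypothesis applies to the enlarged set of constraints.
\<close>

lemma returns_bound:
  assumes "proper_steps (sym_group n) r ls" "successively (turn_ok (fixed_point_free n)) ls"
    and "finite D" "card D + length ls \<le> L" "L < n" "p \<in> {1..n}" "fresh D ls p"
  shows "real (card {g \<in> consistent n r D. returns g x ls p}) \<le>
           real (length ls) * ((real L + 1) / (real n - real L)) * real (card (consistent n r D))"
  using assms
proof (induction ls arbitrary: D p)
  case Nil
  then show ?case by simp
next
  case (Cons s ls)
  obtain i e c where s: "s = (i, e, c)" by (cases s)
  have i: "i \<in> {1..r}" and e: "e \<in> {1, -1}" and c: "c \<in> Sym n" and ls: "proper_steps (sym_group n) r ls"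
    using Cons.prems(1) by (auto simp: s proper_steps_def)
  have cp: "c permutes {1..n}" using c by (simp add: sym_group_carrier)
  let ?\<beta> = "(real L + 1) / (real n - real L)"
  have \<beta>: "?\<beta> \<ge> 0" using Cons.prems(5) by simp
  let ?Q = "{1..n} - used D i (- e)"
  let ?D = "\<lambda>q. insert (constraint i e p q) D"
  let ?N = "\<lambda>q. consistent n r (?D q)"
  define B where "B = {q \<in> ?Q. c q = x \<or> \<not> fresh (?D q) ls (c q)}"
  have pu: "p \<notin> used D i e" using Cons.prems(7) by (simp add: fresh_def s)
  have finB: "finite B" by (simp add: B_def)
  have cardB: "real (card B) \<le> L + 1"
  proof -
    have "card B \<le> card D + 2"
      unfolding B_def
      by (rule card_bad_values[OF Cons.prems(3) c _ e ls])
         (use Cons.prems(2) in \<open>simp add: s successively_Cons\<close>)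
    then show ?thesis using Cons.prems(4) by simp
  qed
  have "{g \<in> consistent n r D. returns g x (s # ls) p} \<subseteq>
      (\<Union>q\<in>B. ?N q) \<union> (\<Union>q\<in>?Q - B. {g \<in> ?N q. returns g x ls (c q)})"
  proof
    fix g assume g: "g \<in> {g \<in> consistent n r D. returns g x (s # ls) p}"
    let ?q = "act g i e p"
    have "?q \<in> ?Q" using act_unused[OF _ i Cons.prems(6) pu e] g by blast
    moreover have "g \<in> ?N ?q" using g by (simp add: consistent_insert[OF i e])
    moreover have "c ?q = x \<or> returns g x ls (c ?q)" using g by (simp add: s)
    ultimately show "g \<in> (\<Union>q\<in>B. ?N q) \<union> (\<Union>q\<in>?Q - B. {g \<in> ?N q. returns g x ls (c q)})"
      by (cases "?q \<in> B") (auto simp: B_def)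
  qed
  then have "card {g \<in> consistent n r D. returns g x (s # ls) p} \<le>
      card ((\<Union>q\<in>B. ?N q) \<union> (\<Union>q\<in>?Q - B. {g \<in> ?N q. returns g x ls (c q)}))"
    by (intro card_mono) (simp_all add: finB)
  also have "\<dots> \<le> card (\<Union>q\<in>B. ?N q) + card (\<Union>q\<in>?Q - B. {g \<in> ?N q. returns g x ls (c q)})"
    by (rule card_Un_le)
  also have "\<dots> \<le> (\<Sum>q\<in>B. card (?N q)) + (\<Sum>q\<in>?Q - B. card {g \<in> ?N q. returns g x ls (c q)})"
    by (intro add_mono card_UN_le) (simp_all add: finB)
  finally have split: "real (card {g \<in> consistent n r D. returns g x (s # ls) p}) \<le>
      (\<Sum>q\<in>B. real (card (?N q))) + (\<Sum>q\<in>?Q - B. real (card {g \<in> ?N q. returns g x ls (c q)}))"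
    by (simp flip: of_nat_sum of_nat_add del: of_nat_add of_nat_sum)
  have "(\<Sum>q\<in>B. real (card (?N q))) \<le> (\<Sum>q\<in>B. card (consistent n r D) / (real n - real L))"
  proof (rule sum_mono)
    fix q assume "q \<in> B"
    then have "q \<in> ?Q" by (simp add: B_def)
    from card_consistent_insert[OF i e this Cons.prems(3), of p]
    have "(real n - real (card D)) * card (?N q) \<le> card (consistent n r D)"
      using Cons.prems(4,5) by (simp flip: of_nat_diff of_nat_mult)
    moreover have "(real n - real L) * card (?N q) \<le> (real n - real (card D)) * card (?N q)"
      using Cons.prems(4) by (intro mult_right_mono) auto
    ultimately show "real (card (?N q)) \<le> card (consistent n r D) / (real n - real L)"
      using Cons.prems(5) by (simp add: field_simps)
  qed
  also have "\<dots> = card B * (card (consistent n r D) / (real n - real L))" by simp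
  also have "\<dots> \<le> (L + 1) * (card (consistent n r D) / (real n - real L))"
    using Cons.prems(5) by (intro mult_right_mono[OF cardB]) simp
  finally have 1: "(\<Sum>q\<in>B. real (card (?N q))) \<le> ?\<beta> * card (consistent n r D)" by (simp add: add.commute)
  have "(\<Sum>q\<in>?Q - B. real (card {g \<in> ?N q. returns g x ls (c q)})) \<le>
      (\<Sum>q\<in>?Q - B. length ls * ?\<beta> * card (?N q))"
  proof (rule sum_mono)
    fix q assume q: "q \<in> ?Q - B"
    have "card (?D q) \<le> card D + 1" using card_insert_le_m1[of "card D + 1" D] by simp
    then show "real (card {g \<in> ?N q. returns g x ls (c q)}) \<le> real (length ls) * ?\<beta> * real (card (?N q))"
    proof (intro Cons.IH ls Cons.prems(5))
      show "successively (turn_ok (fixed_point_free n)) ls"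
        using Cons.prems(2) by (auto simp: successively_Cons)
      show "fresh (?D q) ls (c q)" using q by (auto simp: B_def)
      show "c q \<in> {1..n}" using q permutes_in_image[OF cp, of q] by auto
    qed (use Cons.prems(3,4) \<open>card (?D q) \<le> card D + 1\<close> in auto)
  qed
  also have "\<dots> = length ls * ?\<beta> * (\<Sum>q\<in>?Q - B. card (?N q))" by (simp add: sum_distrib_left)
  also have "(\<Sum>q\<in>?Q - B. card (?N q)) = card (\<Union>q\<in>?Q - B. ?N q)"
    by (rule card_UN_disjoint[symmetric]) (auto simp: consistent_insert[OF i e])
  also have "length ls * ?\<beta> * \<dots> \<le> length ls * ?\<beta> * card (consistent n r D)"
    by (intro mult_left_mono mult_nonneg_nonneg \<beta>)
       (auto intro!: card_mono simp: consistent_insert[OF i e])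
  finally have 2: "(\<Sum>q\<in>?Q - B. real (card {g \<in> ?N q. returns g x ls (c q)})) \<le>
      length ls * ?\<beta> * card (consistent n r D)" .
  have "real (length (s # ls)) = 1 + real (length ls)" by simp
  then have "real (length (s # ls)) * ?\<beta> * real (card (consistent n r D)) =
      ?\<beta> * card (consistent n r D) + length ls * ?\<beta> * card (consistent n r D)"
    by (simp only: distrib_right mult_1)
  with split 1 2 show ?case by linarith
qed

lemma run_append: "run g (us @ vs) p = run g vs (run g us p)"
  by (induction us arbitrary: p) auto

lemma run_replicate: "run g (concat (replicate k vs)) p = (run g vs ^^ k) p"
  by (induction k arbitrary: p) (simp_all add: run_append funpow_swap1)

lemma returns_append: "us \<noteq> [] \<Longrightarrow> run g us p = x \<Longrightarrow> returns g x (us @ vs) p"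
proof (induction us arbitrary: p)
  case (Cons s us)
  then show ?case by (cases us) auto
qed simp

lemma successively_replicate:
  assumes "successively R vs" "R (last vs) (hd vs)" "vs \<noteq> []"
  shows "successively R (concat (replicate k vs))"
proof (induction k)
  case (Suc k)
  then show ?case using assms by (cases k) (auto simp: successively_append_iff)
qed simp

lemma return_probability:
  assumes vs: "proper_steps (sym_group n) r vs" "successively (turn_ok (fixed_point_free n)) vs"
      "turn_ok (fixed_point_free n) (last vs) (hd vs)" "vs \<noteq> []"
    and L: "2 * (K * length vs) \<le> n" and x: "x \<in> {1..n}"
  shows "real (card {g \<in> {1..r} \<rightarrow>\<^sub>E Sym n. \<exists>k\<in>{1..<K}. (run g vs ^^ k) x = x}) \<le>
           4 * real (K * length vs) ^ 2 / n * card ({1..r} \<rightarrow>\<^sub>E Sym n)"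
proof -
  let ?L = "K * length vs" and ?ls = "concat (replicate K vs)" and ?G = "{1..r} \<rightarrow>\<^sub>E Sym n"
  have n: "n > 0" using x by simp
  have G: "consistent n r {} = ?G" by (simp add: consistent_def)
  have len: "length ?ls = ?L" by (simp add: length_concat sum_list_replicate)
  have "{g \<in> ?G. \<exists>k\<in>{1..<K}. (run g vs ^^ k) x = x} \<subseteq> {g \<in> consistent n r {}. returns g x ?ls x}"
  proof
    fix g assume "g \<in> {g \<in> ?G. \<exists>k\<in>{1..<K}. (run g vs ^^ k) x = x}"
    then obtain k where g: "g \<in> ?G" and k: "k \<in> {1..<K}" "(run g vs ^^ k) x = x" by blast
    have "?ls = concat (replicate k vs) @ concat (replicate (K - k) vs)"
      using k(1) by (simp flip: concat_append replicate_add)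
    moreover have "concat (replicate k vs) \<noteq> []" using k(1) vs(4) by auto
    moreover have "run g (concat (replicate k vs)) x = x" using k(2) by (simp add: run_replicate)
    ultimately have "returns g x ?ls x" using returns_append by metis
    with g show "g \<in> {g \<in> consistent n r {}. returns g x ?ls x}" by (simp add: G)
  qed
  then have "real (card {g \<in> ?G. \<exists>k\<in>{1..<K}. (run g vs ^^ k) x = x}) \<le>
      card {g \<in> consistent n r {}. returns g x ?ls x}"
    by (simp add: card_mono)
  also have "\<dots> \<le> real (length ?ls) * ((real ?L + 1) / (real n - real ?L)) * real (card (consistent n r {}))"
  proof (rule returns_bound)
    show "proper_steps (sym_group n) r ?ls" using vs(1) by (auto simp: proper_steps_def)
    show "successively (turn_ok (fixed_point_free n)) ?ls"
      by (rule successively_replicate[OF vs(2-4)])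
    show "fresh {} ?ls x" by (auto simp: fresh_def used_def split: list.splits)
  qed (use L n x len in auto)
  also have "\<dots> = real ?L * ((real ?L + 1) / (real n - real ?L)) * card ?G" by (simp add: len G)
  also have "\<dots> \<le> 4 * real ?L ^ 2 / n * card ?G"
  proof (rule mult_right_mono)
    show "real ?L * ((real ?L + 1) / (real n - real ?L)) \<le> 4 * real ?L ^ 2 / n"
    proof (cases "?L = 0")
      case False
      have Ln: "real ?L \<le> n / 2" using of_nat_mono[OF L, where 'a = real] by simp
      have L1: "1 \<le> real ?L" using False by (simp flip: of_nat_mult add: Suc_le_eq)
      have "(real ?L + 1) / (real n - real ?L) \<le> (2 * ?L) / (n / 2)"
        using L1 Ln n by (intro frac_le) auto
      then have "?L * ((real ?L + 1) / (real n - real ?L)) \<le> ?L * ((2 * ?L) / (n / 2))"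
        by (intro mult_left_mono) auto
      also have "\<dots> = 4 * real ?L ^ 2 / n" by (simp add: power2_eq_square)
      finally show ?thesis .
    qed auto
  qed simp
  finally show ?thesis .
qed

section \<open>Short cycles of the values of a regular word\<close>

lemma short_cycle_points_conj:
  assumes "\<eta> \<in> Sym n"
  shows "short_cycle_points K (\<eta> \<circ> \<sigma> \<circ> inv' \<eta>) {1..n} = \<eta> ` short_cycle_points K \<sigma> {1..n}"
proof -
  have \<eta>: "\<eta> permutes {1..n}" using assms by (simp add: sym_group_carrier)
  have pow: "((\<eta> \<circ> \<sigma> \<circ> inv' \<eta>) ^^ k) (\<eta> x) = \<eta> ((\<sigma> ^^ k) x)" for k x
    by (induction k) (simp_all add: permutes_inverses[OF \<eta>])
  have fix_iff: "((\<eta> \<circ> \<sigma> \<circ> inv' \<eta>) ^^ k) (\<eta> x) = \<eta> x \<longleftrightarrow> (\<sigma> ^^ k) x = x" for k x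
    unfolding pow using permutes_inj[OF \<eta>] by (simp add: inj_eq)
  show ?thesis
  proof (intro equalityI subsetI)
    fix y assume y: "y \<in> short_cycle_points K (\<eta> \<circ> \<sigma> \<circ> inv' \<eta>) {1..n}"
    obtain x where x: "y = \<eta> x" using permutes_surj[OF \<eta>] by blast
    have "x \<in> short_cycle_points K \<sigma> {1..n}"
      using y unfolding x short_cycle_points_def mem_Collect_eq fix_iff permutes_in_image[OF \<eta>] .
    then show "y \<in> \<eta> ` short_cycle_points K \<sigma> {1..n}" using x by blast
  next
    fix y assume "y \<in> \<eta> ` short_cycle_points K \<sigma> {1..n}"
    then obtain x where x: "y = \<eta> x" "x \<in> short_cycle_points K \<sigma> {1..n}" by blast
    from x(2) show "y \<in> short_cycle_points K (\<eta> \<circ> \<sigma> \<circ> inv' \<eta>) {1..n}"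
      unfolding x(1) short_cycle_points_def mem_Collect_eq fix_iff permutes_in_image[OF \<eta>] .
  qed
qed

lemma card_short_cycle_points_conj:
  assumes "\<eta> \<in> Sym n"
  shows "card (short_cycle_points K (\<eta> \<circ> \<sigma> \<circ> inv' \<eta>) {1..n}) = card (short_cycle_points K \<sigma> {1..n})"
proof -
  have "\<eta> permutes {1..n}" using assms by (simp add: sym_group_carrier)
  then show ?thesis
    unfolding short_cycle_points_conj[OF assms] by (intro card_image permutes_inj_on)
qed

text \<open>
  Stated for two mutually inverse functions, since the inverse of a value of a word arises as a
  run through the word.
\<close>

lemma short_cycle_points_inverse:
  assumes "\<And>x. \<tau> (\<sigma> x) = x" "\<And>x. \<sigma> (\<tau> x) = x"
  shows "short_cycle_points K \<tau> S = short_cycle_points K \<sigma> S"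
proof -
  have "(g ^^ k) ((f ^^ k) x) = x" if "\<And>x. g (f x) = x" for f g :: "'a \<Rightarrow> 'a" and k x
    by (induction k arbitrary: x) (simp_all add: that funpow_swap1)
  then have "(\<tau> ^^ k) x = x \<longleftrightarrow> (\<sigma> ^^ k) x = x" for k x
    using assms by metis
  then show ?thesis by (simp add: short_cycle_points_def)
qed

text \<open>
  The product \<open>x_1 c_1 \<dots> x_l c_l\<close> acts from right to left. Its inverse acts by the inverse of \<open>x_1\<close>,
  then by the inverse of \<open>c_1\<close>, and so on, hence is a run through the entries in their given order.
\<close>

definition inverse_steps :: "step list \<Rightarrow> step list" where
  "inverse_steps ls = map (\<lambda>(i, e, c). (i, - e, inv' c)) ls"

lemma letters_val_Cons:
  "letters_val (sym_group n) g (x # u) = letter_val (sym_group n) g x \<circ> letters_val (sym_group n) g u"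
  by (simp add: letters_val_def sym_group_mult)

lemma act_neg_letter_val:
  assumes "g \<in> {1..r} \<rightarrow> Sym n" "i \<in> {1..r}" "e \<in> {1, -1}"
  shows "act g i (- e) (letter_val (sym_group n) g (Gen i e) y) = y"
proof -
  interpret group "sym_group n" by (rule sym_group_is_group)
  have gi: "g i \<in> Sym n" using assms(1,2) by auto
  show ?thesis using assms(3) gi Sym_inverses[OF gi] by (auto simp: act_def int_pow_neg)
qed

lemma run_inverse_steps:
  assumes g: "g \<in> {1..r} \<rightarrow> Sym n" and ls: "proper_steps (sym_group n) r ls"
  shows "run g (inverse_steps ls) (letters_val (sym_group n) g (step_letters ls) p) = p"
  using ls
proof (induction ls)
  case Nil
  show ?case by (simp add: inverse_steps_def letters_val_def sym_group_one)
next
  case (Cons s ls)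
  obtain i e c where s: "s = (i, e, c)" by (cases s)
  then have "i \<in> {1..r}" "e \<in> {1, -1}" "c \<in> Sym n" using Cons.prems by simp_all
  then show ?case using Cons act_neg_letter_val[OF g, of i e] Sym_inverses[of c n]
    by (simp add: s inverse_steps_def letters_val_Cons)
qed

lemma cyclic_inverse_steps:
  assumes "proper_steps (sym_group n) r vs" "successively (turn_ok (fixed_point_free n)) vs"
    "turn_ok (fixed_point_free n) (last vs) (hd vs)" "vs \<noteq> []"
  shows "proper_steps (sym_group n) r (inverse_steps vs)"
    "successively (turn_ok (fixed_point_free n)) (inverse_steps vs)"
    "turn_ok (fixed_point_free n) (last (inverse_steps vs)) (hd (inverse_steps vs))"
proof -
  show "proper_steps (sym_group n) r (inverse_steps vs)"
    using assms(1) by (auto simp: inverse_steps_def proper_steps_def Sym_inv)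
  have fpf: "fixed_point_free n (inv' c)" if "c \<in> Sym n" "fixed_point_free n c" for c
    using that Sym_inverses[OF that(1)] unfolding fixed_point_free_def by metis
  have turn: "turn_ok (fixed_point_free n) (i, - e, inv' c) (i', - e', inv' c')"
    if "turn_ok (fixed_point_free n) (i, e, c) (i', e', c')" "c \<in> Sym n" for i e c i' e' c'
    using that fpf by (auto simp: turn_ok_def)
  have car: "c \<in> Sym n" if "(i, e, c) \<in> set vs" for i e c
    using assms(1) that by (auto simp: proper_steps_def)
  show "successively (turn_ok (fixed_point_free n)) (inverse_steps vs)"
    unfolding inverse_steps_def successively_map
    by (rule successively_mono[OF assms(2)]) (auto intro!: turn car)
  obtain i e c where last: "last vs = (i, e, c)" by (cases "last vs")
  obtain i' e' c' where hd: "hd vs = (i', e', c')" by (cases "hd vs")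
  have "(i, e, c) \<in> set vs" using last_in_set[OF assms(4)] by (simp only: last)
  then have "turn_ok (fixed_point_free n) (i, - e, inv' c) (i', - e', inv' c')"
    using assms(3) unfolding last hd by (intro turn car)
  moreover have "last (inverse_steps vs) = (i, - e, inv' c)" "hd (inverse_steps vs) = (i', - e', inv' c')"
    using assms(4) last hd by (simp_all add: inverse_steps_def last_map hd_map)
  ultimately show "turn_ok (fixed_point_free n) (last (inverse_steps vs)) (hd (inverse_steps vs))"
    by (simp only:)
qed

text \<open>
  Conjugate elements have equally many points on short cycles, and so do a permutation and its
  inverse. The bound \<open>n \<ge> 3\<close> makes the centre of \<open>S_n\<close> trivial, so that a critical constant that
  prevents reducedness is trivial and its two neighbours cancel.
\<close>

lemma regular_word_steps:
  assumes n: "n \<ge> 3" and w: "regular n r w" and l: "cword_length w \<ge> 1"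
  obtains vs where "vs \<noteq> []" "length vs \<le> cword_length w"
    "proper_steps (sym_group n) r vs" "successively (turn_ok (fixed_point_free n)) vs"
    "turn_ok (fixed_point_free n) (last vs) (hd vs)"
    "\<And>g K. g \<in> {1..r} \<rightarrow>\<^sub>E Sym n \<Longrightarrow>
       card (short_cycle_points K (word_map (sym_group n) r w g) {1..n}) =
       card (short_cycle_points K (run g vs) {1..n})"
proof -
  let ?G = "sym_group n"
  note G = sym_group_is_group[of n]
  have reg: "cword ?G r w" "reduced ?G w" "\<not> conjugate_to_const ?G r (cword_elem ?G r w)"
    and fpf: "\<And>u. reduced_form ?G r u (cword_elem ?G r w [^]\<^bsub>free_prod ?G r\<^esub> (2::nat)) \<Longrightarrow>
      \<forall>j\<in>critical_indices u. fixed_point_free n (word_const u j)"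
    using w unfolding regular_def by blast+
  have "snd w \<noteq> []" using l by (auto simp: cword_length_def)
  obtain u vs h h' where u: "reduced_form ?G r u (cword_elem ?G r w [^]\<^bsub>free_prod ?G r\<^esub> (2::nat))"
    and vs: "vs \<noteq> []" "length vs \<le> cword_length w" "proper_steps ?G r vs"
    and cyc: "\<And>P. (\<forall>j\<in>critical_indices u. P (word_const u j)) \<Longrightarrow>
       successively (turn_ok P) vs \<and> turn_ok P (last vs) (hd vs)"
    and h: "h \<in> lists (alphabet ?G r)" "h' \<in> lists (alphabet ?G r)" "fp_cong ?G r (h' @ h) []"
      "cword_elem ?G r w = fp_class ?G r (h @ step_letters vs @ h')"
    by (rule cyclic_core[OF G center_sym_group[OF n] reg \<open>snd w \<noteq> []\<close>]) (rule that)
  have turn: "successively (turn_ok (fixed_point_free n)) vs" "turn_ok (fixed_point_free n) (last vs) (hd vs)"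
    using cyc[OF fpf[OF u]] by auto
  show ?thesis
  proof (rule that[of "inverse_steps vs"])
    fix g K assume g: "g \<in> {1..r} \<rightarrow>\<^sub>E Sym n"
    then have g': "g \<in> {1..r} \<rightarrow> Sym n" by auto
    define \<eta> where "\<eta> = letters_val ?G g h"
    define \<eta>' where "\<eta>' = letters_val ?G g h'"
    define \<sigma> where "\<sigma> = letters_val ?G g (step_letters vs)"
    have Syms: "\<eta> \<in> Sym n" "\<eta>' \<in> Sym n" "\<sigma> \<in> Sym n"
      unfolding \<eta>_def \<eta>'_def \<sigma>_def by (intro letters_val_closed[OF G g'] h step_letters_in vs)+
    have "\<eta>' \<circ> \<eta> = id"
      using letters_val_cong[OF G g' h(3)] letters_val_append[OF G g' h(2,1)]
      by (simp add: \<eta>_def \<eta>'_def sym_group_mult letters_val_def sym_group_one)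
    then have "\<eta>' (\<eta> y) = y" for y by (simp add: fun_eq_iff)
    from this[of "inv' \<eta> y" for y] have \<eta>': "\<eta>' = inv' \<eta>"
      by (simp add: fun_eq_iff Sym_inverses(1)[OF Syms(1)])
    have "word_map ?G r w g = letters_val ?G g (h @ step_letters vs @ h')"
      unfolding word_map_def h(4) using h(1,2) vs(3) by (intro subst_hom_class[OF G g']) simp
    also have "\<dots> = \<eta> \<circ> (\<sigma> \<circ> \<eta>')"
      using h(1,2) vs(3) by (simp add: letters_val_append[OF G g'] sym_group_mult \<eta>_def \<eta>'_def \<sigma>_def)
    finally have "card (short_cycle_points K (word_map ?G r w g) {1..n}) =
        card (short_cycle_points K \<sigma> {1..n})"
      using card_short_cycle_points_conj[OF Syms(1), of K \<sigma>] by (simp add: \<eta>' o_assoc)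
    also have "short_cycle_points K \<sigma> {1..n} = short_cycle_points K (run g (inverse_steps vs)) {1..n}"
    proof (rule short_cycle_points_inverse[symmetric])
      show inv: "run g (inverse_steps vs) (\<sigma> x) = x" for x
        unfolding \<sigma>_def by (rule run_inverse_steps[OF g' vs(3)])
      show "\<sigma> (run g (inverse_steps vs) x) = x" for x
        using inv[of "inv' \<sigma> x"] Sym_inverses[OF Syms(3)] by simp
    qed
    finally show "card (short_cycle_points K (word_map ?G r w g) {1..n}) =
        card (short_cycle_points K (run g (inverse_steps vs)) {1..n})" .
  qed (use vs cyclic_inverse_steps[OF vs(3) turn vs(1)] in \<open>auto simp: inverse_steps_def\<close>)
qed

section \<open>The distance to the uniform measure\<close>

lemma expected_short_cycle_points:
  assumes vs: "proper_steps (sym_group n) r vs" "successively (turn_ok (fixed_point_free n)) vs"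
      "turn_ok (fixed_point_free n) (last vs) (hd vs)" "vs \<noteq> []"
    and L: "2 * (K * length vs) \<le> n" and n: "n > 0"
    and W: "\<And>g. g \<in> {1..r} \<rightarrow>\<^sub>E Sym n \<Longrightarrow>
       card (short_cycle_points K (W g) {1..n}) = card (short_cycle_points K (run g vs) {1..n})"
  shows "measure_pmf.expectation (map_pmf W (pmf_of_set ({1..r} \<rightarrow>\<^sub>E Sym n)))
           (\<lambda>\<pi>. 1 / K + card (short_cycle_points K \<pi> {1..n}) / n)
         \<le> 1 / K + 4 * real (K * length vs) ^ 2 / n"
proof -
  let ?G = "{1..r} \<rightarrow>\<^sub>E Sym n"
  let ?N = "real (card ?G)"
  have fin: "finite ?G" and ne: "?G \<noteq> {}"
    using sym_group_finite[of n] by (auto intro!: finite_PiE simp: PiE_eq_empty_iff)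
  then have N: "?N > 0" by (simp add: card_gt_0_iff)
  have "(\<Sum>g\<in>?G. card (short_cycle_points K (run g vs) {1..n})) =
      (\<Sum>g\<in>?G. \<Sum>x\<in>{1..n}. of_bool (\<exists>k\<in>{1..<K}. (run g vs ^^ k) x = x))"
    by (intro sum.cong) (auto simp: short_cycle_points_def Int_def)
  also have "\<dots> = (\<Sum>x\<in>{1..n}. \<Sum>g\<in>?G. of_bool (\<exists>k\<in>{1..<K}. (run g vs ^^ k) x = x))"
    by (rule sum.swap)
  also have "\<dots> = (\<Sum>x\<in>{1..n}. card {g \<in> ?G. \<exists>k\<in>{1..<K}. (run g vs ^^ k) x = x})"
    using fin by (intro sum.cong) (auto simp: Int_def)
  finally have "real (\<Sum>g\<in>?G. card (short_cycle_points K (run g vs) {1..n})) =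
      (\<Sum>x\<in>{1..n}. real (card {g \<in> ?G. \<exists>k\<in>{1..<K}. (run g vs ^^ k) x = x}))"
    by simp
  also have "\<dots> \<le> (\<Sum>x\<in>{1..n}. 4 * real (K * length vs) ^ 2 / n * ?N)"
    by (intro sum_mono return_probability vs L)
  also have "\<dots> = n * (4 * real (K * length vs) ^ 2 / n * ?N)" by simp
  finally have le: "(\<Sum>g\<in>?G. real (card (short_cycle_points K (run g vs) {1..n}))) \<le>
      n * (4 * real (K * length vs) ^ 2 / n * ?N)" by simp
  have "measure_pmf.expectation (map_pmf W (pmf_of_set ?G))
      (\<lambda>\<pi>. 1 / K + card (short_cycle_points K \<pi> {1..n}) / n) =
      (\<Sum>g\<in>?G. 1 / K + card (short_cycle_points K (W g) {1..n}) / n) / ?N"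
    unfolding integral_map_pmf by (rule integral_pmf_of_set[OF ne fin])
  also have "(\<Sum>g\<in>?G. 1 / K + card (short_cycle_points K (W g) {1..n}) / n) =
      (\<Sum>g\<in>?G. 1 / K + card (short_cycle_points K (run g vs) {1..n}) / n)"
    by (intro sum.cong HOL.refl) (simp only: W)
  also have "\<dots> = ?N * (1 / K) + (\<Sum>g\<in>?G. real (card (short_cycle_points K (run g vs) {1..n}))) / n"
    by (simp only: sum.distrib sum_constant sum_divide_distrib)
  also have "\<dots> \<le> ?N * (1 / K) + n * (4 * real (K * length vs) ^ 2 / n * ?N) / n"
    by (intro add_left_mono divide_right_mono le) simp
  also have "\<dots> = (1 / K + 4 * real (K * length vs) ^ 2 / n) * ?N"
    using n by (simp add: distrib_right)
  finally show ?thesis using N by (simp add: divide_right_mono pos_divide_le_eq)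
qed

text \<open>
  The uniform measure is the measure of the word \<open>x_1\<close>, which has no critical constants.
\<close>

lemma unif_measure_eq:
  "unif_measure n = map_pmf (\<lambda>g. g 1) (pmf_of_set ({1..1::nat} \<rightarrow>\<^sub>E Sym n))"
proof -
  have b: "bij_betw (\<lambda>g. g 1) ({1..1::nat} \<rightarrow>\<^sub>E Sym n) (Sym n)"
    by (rule bij_betw_byWitness[where f' = "\<lambda>\<sigma>. \<lambda>i\<in>{1..1}. \<sigma>"])
       (auto simp: fun_eq_iff PiE_iff extensional_def)
  have f: "finite ({1..1::nat} \<rightarrow>\<^sub>E Sym n)" "({1..1::nat} \<rightarrow>\<^sub>E Sym n) \<noteq> {}"
    using sym_group_finite[of n] by (auto intro!: finite_PiE simp: PiE_eq_empty_iff)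
  show ?thesis
    unfolding unif_measure_def by (rule map_pmf_of_set_bij_betw[OF b f(2,1), symmetric])
qed

lemma word_measure_support:
  assumes "cword (sym_group n) r w"
  shows "set_pmf (word_measure (sym_group n) r w) \<subseteq> Sym n"
proof -
  have "finite ({1..r} \<rightarrow>\<^sub>E Sym n)" "({1..r} \<rightarrow>\<^sub>E Sym n) \<noteq> {}"
    using sym_group_finite[of n] by (auto intro!: finite_PiE simp: PiE_eq_empty_iff)
  moreover have "word_map (sym_group n) r w g \<in> Sym n" if "g \<in> {1..r} \<rightarrow>\<^sub>E Sym n" for g
  proof -
    obtain a ms where w: "w = (a, ms)" by (cases w)
    have u: "Const a # step_letters ms \<in> lists (alphabet (sym_group n) r)"
      using assms by (simp add: w cword_eq)
    have g: "g \<in> {1..r} \<rightarrow> Sym n" using that by auto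
    show ?thesis
      unfolding word_map_def w cword_elem_eq subst_hom_class[OF sym_group_is_group g u]
      by (rule letters_val_closed[OF sym_group_is_group g u])
  qed
  ultimately show ?thesis by (auto simp: word_measure_def)
qed

lemma kantorovich_le_1:
  assumes "set_pmf \<mu> \<subseteq> Sym n"
  shows "kantorovich n (symmetrization n \<mu>) (unif_measure n) \<le> 1"
proof -
  have "id \<in> Sym n" by (simp add: sym_group_carrier permutes_id)
  then have "kantorovich n (symmetrization n \<mu>) (unif_measure n) \<le>
      measure_pmf.expectation \<mu> (\<lambda>_. 1) + measure_pmf.expectation (unif_measure n) (\<lambda>_. 0)"
    using hamming_le_1[of n] by (intro kantorovich_symmetrization_le[OF assms]) auto
  then show ?thesis by simp
qed

text \<open>
  Half of the bound comes from the values of \<open>w\<close>, the other half from the uniform permutation,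
  which is the value of a word of length \<open>1\<close>.
\<close>

lemma kantorovich_regular_word_le:
  assumes n: "n \<ge> 3" and w: "regular n r w" and l: "cword_length w = l" "l \<ge> 1"
    and K: "K > 0" "2 * (K * l) \<le> n"
  shows "kantorovich n (symmetrization n (word_measure (sym_group n) r w)) (unif_measure n)
           \<le> 2 / K + 8 * real (K * l) ^ 2 / n"
proof -
  let ?F = "\<lambda>\<pi>. 1 / real K + real (card (short_cycle_points K \<pi> {1..n})) / real n"
  obtain vs where vs: "vs \<noteq> []" "length vs \<le> l"
    "proper_steps (sym_group n) r vs" "successively (turn_ok (fixed_point_free n)) vs"
    "turn_ok (fixed_point_free n) (last vs) (hd vs)"
    "\<And>g K. g \<in> {1..r} \<rightarrow>\<^sub>E Sym n \<Longrightarrow>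
       card (short_cycle_points K (word_map (sym_group n) r w g) {1..n}) =
       card (short_cycle_points K (run g vs) {1..n})"
    using regular_word_steps[OF n w] l by metis
  have mono: "4 * real (K * m) ^ 2 / n \<le> 4 * real (K * l) ^ 2 / n" if "m \<le> l" for m
    using that by (intro divide_right_mono mult_left_mono power_mono of_nat_mono mult_le_mono2) auto
  have short: "2 * (K * m) \<le> n" if "m \<le> l" for m
    using that K(2) by (meson le_trans mult_le_mono2)
  have cw: "cword (sym_group n) r w" using w by (simp add: regular_def)
  have le: "kantorovich n (symmetrization n (word_measure (sym_group n) r w)) (unif_measure n) \<le>
      measure_pmf.expectation (word_measure (sym_group n) r w) ?F +
      measure_pmf.expectation (unif_measure n) ?F"
    using conjugate_close[OF _ _ K(1)] n
    by (intro kantorovich_symmetrization_le word_measure_support[OF cw]) auto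
  have "measure_pmf.expectation (word_measure (sym_group n) r w) ?F \<le>
      1 / K + 4 * real (K * length vs) ^ 2 / n"
    unfolding word_measure_def
    by (intro expected_short_cycle_points vs short) (use n in auto)
  also have "\<dots> \<le> 1 / K + 4 * real (K * l) ^ 2 / n"
    using mono[OF vs(2)] by simp
  finally have word: "measure_pmf.expectation (word_measure (sym_group n) r w) ?F \<le>
      1 / K + 4 * real (K * l) ^ 2 / n" .
  have "run g [(Suc 0, 1, id)] = g (Suc 0)" for g
    by (simp add: fun_eq_iff act_def)
  then have "measure_pmf.expectation (unif_measure n) ?F \<le>
      1 / K + 4 * real (K * length [(1::nat, 1::int, id :: nat \<Rightarrow> nat)]) ^ 2 / n"
    unfolding unif_measure_eq
    by (intro expected_short_cycle_points)
       (use n short[OF l(2)] in \<open>auto simp: proper_steps_def sym_group_carrier permutes_id turn_ok_def \<close>)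
  also have "\<dots> \<le> 1 / K + 4 * real (K * l) ^ 2 / n"
    using mono[OF l(2)] by simp
  finally have unif: "measure_pmf.expectation (unif_measure n) ?F \<le> 1 / K + 4 * real (K * l) ^ 2 / n" .
  show ?thesis using le word unif by simp
qed

theorem theorem1p2:
  fixes \<epsilon> :: real
  assumes "\<epsilon> > 0"
  shows "\<exists>c>0. \<forall>(n::nat)\<ge>1. \<forall>(r::nat)\<ge>1. \<forall>(w::(nat \<Rightarrow> nat) cword) (l::nat).
           regular n r w \<and> cword_length w = l \<and> l \<ge> 1 \<longrightarrow>
           kantorovich n (symmetrization n (word_measure (sym_group n) r w)) (unif_measure n)
             \<le> c * real l ^ 2 * real n powr (- 1 / 3 + \<epsilon>)"
proof -
  have "kantorovich n (symmetrization n (word_measure (sym_group n) r w)) (unif_measure n)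
      \<le> 34 * real l ^ 2 * real n powr (- 1 / 3 + \<epsilon>)"
    if n: "n \<ge> 1" and w: "regular n r w" and l: "cword_length w = l" "l \<ge> 1"
    for n r l :: nat and w :: "(nat \<Rightarrow> nat) cword"
  proof -
    let ?k = "kantorovich n (symmetrization n (word_measure (sym_group n) r w)) (unif_measure n)"
    \<comment> \<open>The cutoff \<open>K\<close> is \<open>t\<close> rounded up, which balances \<open>1 / K\<close> against \<open>K\<^sup>2 / n\<close>.\<close>
    define t where "t = real n powr (1 / 3)"
    have t: "t \<ge> 1" using n by (simp add: t_def ge_one_powr_ge_zero)
    have "t ^ 3 = t powr 3" using t powr_realpow[of t 3] by simp
    also have "\<dots> = n" using n by (simp add: t_def powr_powr)
    finally have t3: "t ^ 3 = n" .
    have l1: "1 \<le> real l ^ 2" using l(2) by simp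
    have "?k \<le> 34 * real l ^ 2 / t"
    proof (cases "n \<ge> 3 \<and> 2 * (nat \<lceil>t\<rceil> * l) \<le> n")
      case True
      define K where "K = nat \<lceil>t\<rceil>"
      have K: "real K \<ge> t" "real K \<le> 2 * t" "K > 0"
        unfolding K_def using t by linarith+
      have Kl: "real (K * l) \<le> 2 * t * l" using K(2) by (simp add: mult_right_mono)
      have "?k \<le> 2 / K + 8 * real (K * l) ^ 2 / n"
        using True by (intro kantorovich_regular_word_le w l K(3)) (auto simp: K_def)
      also have "\<dots> \<le> 2 / t + 8 * (2 * t * l) ^ 2 / n"
        using K Kl t n by (intro add_mono divide_left_mono divide_right_mono mult_left_mono power_mono) auto
      also have "\<dots> = (2 + 32 * real l ^ 2) / t"
        using t by (simp add: t3[symmetric] field_simps power2_eq_square power3_eq_cube)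
      also have "\<dots> \<le> 34 * real l ^ 2 / t"
        using l1 t by (intro divide_right_mono) auto
      finally show ?thesis .
    next
      case False
      \<comment> \<open>For long words and for \<open>n < 3\<close> the claimed bound exceeds the diameter \<open>1\<close>.\<close>
      have "t \<le> 34 * real l ^ 2"
      proof (cases "n \<ge> 3")
        case True
        then have "real n < 2 * (nat \<lceil>t\<rceil> * l)" using False by linarith
        also have "\<dots> = 2 * real (nat \<lceil>t\<rceil>) * l" by simp
        also have "\<dots> \<le> 2 * (2 * t) * l"
          using t by (intro mult_right_mono mult_left_mono) linarith+
        finally have "t * t ^ 2 < t * (4 * l)" by (simp add: t3[symmetric] power3_eq_cube power2_eq_square)
        then have "t ^ 2 < 4 * l" using t by (simp add: mult_less_cancel_left)
        moreover have "t \<le> t ^ 2" using t by (simp add: power2_eq_square)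
        moreover have "real l \<le> real l ^ 2" using l(2) by (simp add: power2_eq_square)
        ultimately show ?thesis by linarith
      next
        case False
        have "t \<le> t ^ 3" using t power_increasing[of 1 3 t] by simp
        with False t3 have "t \<le> 2" by simp
        with l1 show ?thesis by linarith
      qed
      then have "1 \<le> 34 * real l ^ 2 / t" using t by simp
      moreover have "?k \<le> 1"
        using w by (intro kantorovich_le_1 word_measure_support) (simp add: regular_def)
      ultimately show ?thesis by linarith
    qed
    also have "34 * real l ^ 2 / t = 34 * real l ^ 2 * real n powr (- 1 / 3)"
      using powr_minus_divide[of "real n" "1 / 3"] by (simp add: t_def)
    also have "\<dots> \<le> 34 * real l ^ 2 * real n powr (- 1 / 3 + \<epsilon>)"
      using n assms by (intro mult_left_mono powr_mono) auto
    finally show ?thesis .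
  qed
  then have "\<forall>n\<ge>1. \<forall>r\<ge>1. \<forall>(w::(nat \<Rightarrow> nat) cword) l.
      regular n r w \<and> cword_length w = l \<and> l \<ge> 1 \<longrightarrow>
      kantorovich n (symmetrization n (word_measure (sym_group n) r w)) (unif_measure n)
        \<le> 34 * real l ^ 2 * real n powr (- 1 / 3 + \<epsilon>)"
    by blast
  then show ?thesis by (intro exI[of _ 34] conjI) simp_all
qed

end
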